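(* Let $y$ be an algebraic function of complex variables $x_1,\dots,x_N$. If the monodromy group of $y$ is solvable, then $y$ can be represented by rational functions (of $x_1,\dots,x_N$) by means of root extractions and summations.
   Context: An algebraic function $y$ of $N$ complex variables is the multivalued analytic function defined by an equation $P_ny^n+\dots+P_0=0$ irreducible over the field of rational functions of $x_1,\dots,x_N$, where the $P_i$ are polynomials in $x_1,\dots,x_N$ and $P_n\ne0$. Let $\Sigma\subset\mathbb C^N$ be the hypersurface $P_nJ=0$, where $J$ is the discriminant of the equation. For $x_0\in\mathbb C^N\setminus\Sigma$ there are exactly $n$ germs of analytic functions at $x_0$ satisfying the equation; analytic continuation of these germs along loops in $\mathbb C^N\setminus\Sigma$ based at $x_0$ defines a homomorphism from $\pi_1(\mathbb C^N\setminus\Sigma,x_0)$ to the group of permutations of the $n$ germs. Its image is the monodromy group of $y$ (independent of $x_0$ up to isomorphism). "Represented by rational functions by root extractions and summations" means: $y$ belongs to the smallest class of multivalued functions of $x_1,\dots,x_N$ containing all rational functions and closed under the operations of summation and of extraction of $q$-th roots ($q\ge 2$ integer). Here a multivalued function is representable as the sum of multivalued functions $f,g$ if it is generated (by analytic continuation) by a germ $f_a+g_a$, where $f_a$, $g_a$ are germs of $f$, $g$ at the same point $a$; and it is a $q$-th root of $f$ if it is generated by a germ $h_a$ with $h_a^q=f_a$ for a germ $f_a$ of $f$. *)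

theory Defs
  imports
    "HOL-Analysis.Analysis"
    "HOL-Library.Poly_Mapping"
    "HOL-Computational_Algebra.Polynomial_Factorial"
    "HOL-Algebra.Bij"
    "HOL-Algebra.Solvable_Groups"
    "Subresultants.Resultant_Prelim"
begin

section \<open>Polynomials in several complex variables\<close>

text \<open>
  The variables are indexed by a type \<open>'n\<close>, so \<open>\<complex>\<^sup>N\<close> is \<^typ>\<open>complex ^ 'n\<close> with \<open>N = CARD('n)\<close>.
  Monomials are exponent vectors \<^typ>\<open>'n \<Rightarrow>\<^sub>0 nat\<close>. A linear order on \<open>'n\<close> has no mathematical
  meaning; it is what the library needs to see that this polynomial ring is an integral domain.
\<close>

type_synonym 'n mpoly = "('n \<Rightarrow>\<^sub>0 nat) \<Rightarrow>\<^sub>0 complex"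

definition mpoly_eval :: "'n::finite mpoly \<Rightarrow> complex ^ 'n \<Rightarrow> complex" where
  "mpoly_eval p x =
     (\<Sum>m\<in>Poly_Mapping.keys p. Poly_Mapping.lookup p m *
        (\<Prod>i\<in>UNIV. vec_nth x i ^ Poly_Mapping.lookup m i))"

text \<open>The equation \<open>P\<^sub>n y\<^sup>n + \<dots> + P\<^sub>0 = 0\<close> is given by \<open>P :: 'n mpoly poly\<close>, a polynomial in \<open>y\<close>.\<close>

definition equation_at :: "'n::finite mpoly poly \<Rightarrow> complex ^ 'n \<Rightarrow> complex poly" where
  "equation_at P x = map_poly (\<lambda>c. mpoly_eval c x) P"

definition discriminant :: "complex poly \<Rightarrow> complex" where
  "discriminant p =
     (- 1) ^ (degree p * (degree p - 1) div 2) * resultant p (pderiv p) / lead_coeff p"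

text \<open>
  The hypersurface \<open>P\<^sub>n J = 0\<close>. At a point where \<open>P\<^sub>n\<close> does not vanish, specialising the
  coefficients preserves the degree in \<open>y\<close>, so the value of \<open>J\<close> there is the discriminant of
  the specialised equation; where \<open>P\<^sub>n\<close> vanishes the second factor is irrelevant.
\<close>

definition branch_locus :: "'n::finite mpoly poly \<Rightarrow> (complex ^ 'n) set" where
  "branch_locus P =
     {x. mpoly_eval (lead_coeff P) x * discriminant (equation_at P x) = 0}"

section \<open>Germs of analytic functions and analytic continuation\<close>

text \<open>
  Analyticity in several variables is complex Frechet differentiability in a neighbourhood,
  in line with \<^const>\<open>analytic_on\<close> for one variable.
\<close>

definition holomorphic_several :: "(complex ^ 'n \<Rightarrow> complex) \<Rightarrow> (complex ^ 'n) set \<Rightarrow> bool" where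
  "holomorphic_several f U \<longleftrightarrow>
     (\<forall>z\<in>U. \<exists>f'. (f has_derivative f') (at z) \<and> (\<forall>c v. f' (c *s v) = c * f' v))"

definition analytic_near :: "(complex ^ 'n \<Rightarrow> complex) \<Rightarrow> complex ^ 'n \<Rightarrow> bool" where
  "analytic_near f a \<longleftrightarrow> (\<exists>U. open U \<and> a \<in> U \<and> holomorphic_several f U)"

text \<open>A germ is its base point together with an equivalence class of functions.\<close>

type_synonym 'n germ = "(complex ^ 'n) \<times> (complex ^ 'n \<Rightarrow> complex) set"

definition germ_at :: "complex ^ 'n \<Rightarrow> (complex ^ 'n \<Rightarrow> complex) \<Rightarrow> 'n germ" where
  "germ_at a f = (a, {g. \<forall>\<^sub>F x in nhds a. g x = f x})"

text \<open>A family of germs along a path that is locally induced by one analytic function.\<close>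

definition continuation_along :: "(real \<Rightarrow> complex ^ 'n) \<Rightarrow> (real \<Rightarrow> 'n germ) \<Rightarrow> bool" where
  "continuation_along \<gamma> F \<longleftrightarrow> path \<gamma> \<and>
     (\<forall>t\<in>{0..1}. \<exists>U f. open U \<and> \<gamma> t \<in> U \<and> holomorphic_several f U \<and>
        (\<exists>e>0. \<forall>s\<in>{0..1}. \<bar>s - t\<bar> < e \<longrightarrow> \<gamma> s \<in> U \<and> F s = germ_at (\<gamma> s) f))"

definition continues_to :: "(real \<Rightarrow> complex ^ 'n::finite) \<Rightarrow> 'n germ \<Rightarrow> 'n germ \<Rightarrow> bool" where
  "continues_to \<gamma> g h \<longleftrightarrow> (\<exists>F. continuation_along \<gamma> F \<and> F 0 = g \<and> F 1 = h)"

text \<open>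
  A multivalued analytic function is the set of all germs obtained from one analytic germ by
  continuation along paths in \<open>\<complex>\<^sup>N\<close> (all those along which continuation is possible).
\<close>

definition generated_by :: "'n::finite germ \<Rightarrow> 'n germ set" where
  "generated_by g = {h. \<exists>\<gamma>. continues_to \<gamma> g h}"

section \<open>Algebraic functions and their monodromy\<close>

definition solution_germs :: "'n::finite mpoly poly \<Rightarrow> complex ^ 'n \<Rightarrow> 'n germ set" where
  "solution_germs P a =
     {germ_at a f | f. analytic_near f a \<and> (\<forall>\<^sub>F x in nhds a. poly (equation_at P x) (f x) = 0)}"

definition algebraic_function :: "'n::{finite,linorder} mpoly poly \<Rightarrow> 'n germ set \<Rightarrow> bool" where
  "algebraic_function P y \<longleftrightarrow>
     irreducible (map_poly to_fract P) \<and> (\<exists>a. \<exists>g\<in>solution_germs P a. y = generated_by g)"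

definition loops_avoiding :: "(complex ^ 'n) set \<Rightarrow> complex ^ 'n \<Rightarrow> (real \<Rightarrow> complex ^ 'n) set" where
  "loops_avoiding S a =
     {\<gamma>. path \<gamma> \<and> pathstart \<gamma> = a \<and> pathfinish \<gamma> = a \<and> path_image \<gamma> \<inter> S = {}}"

definition monodromy_perm ::
    "'n::finite mpoly poly \<Rightarrow> complex ^ 'n \<Rightarrow> (real \<Rightarrow> complex ^ 'n) \<Rightarrow> 'n germ \<Rightarrow> 'n germ" where
  "monodromy_perm P a \<gamma> = (\<lambda>g\<in>solution_germs P a. THE h. continues_to \<gamma> g h)"

text \<open>
  The image of the fundamental group in the permutations of the germs at \<open>a\<close>. Homotopic loops
  induce the same permutation, so it is taken directly over loops.
\<close>

definition monodromy_group :: "'n::finite mpoly poly \<Rightarrow> complex ^ 'n \<Rightarrow> ('n germ \<Rightarrow> 'n germ) monoid" where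
  "monodromy_group P a =
     BijGroup (solution_germs P a)
       \<lparr>carrier := monodromy_perm P a ` loops_avoiding (branch_locus P) a\<rparr>"

section \<open>Representability by root extractions and summations\<close>

inductive_set representable :: "'n::finite germ set set" where
  rational: "mpoly_eval q a \<noteq> 0 \<Longrightarrow>
    generated_by (germ_at a (\<lambda>x. mpoly_eval p x / mpoly_eval q x)) \<in> representable"
| sum: "\<lbrakk>F \<in> representable; G \<in> representable; germ_at a f \<in> F; germ_at a g \<in> G\<rbrakk> \<Longrightarrow>
    generated_by (germ_at a (\<lambda>x. f x + g x)) \<in> representable"
| root: "\<lbrakk>F \<in> representable; q \<ge> 2; analytic_near h a; germ_at a (\<lambda>x. h x ^ q) \<in> F\<rbrakk> \<Longrightarrow>
    generated_by (germ_at a h) \<in> representable"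

end

theory Submission
  imports Defs
    "HOL-Computational_Algebra.Fundamental_Theorem_Algebra"
    "HOL-Combinatorics.Cycles"
    "HOL-Complex_Analysis.Residue_Theorem"
begin

text \<open>
Outside the branch locus \<open>\<Sigma>\<close> the equation has \<open>n\<close> simple roots, so locally there are \<open>n\<close> holomorphic
branches. They can be continued along every path avoiding \<open>\<Sigma>\<close>, and loops permute the set \<open>R\<close> of
branches at \<open>x\<^sub>0\<close>. Instead of developing the Galois theory of the field generated by the branches, the
proof lets the monodromy group act on a ring in which nothing has to be continued: the polynomial
functions \<open>Q\<close> of independent variables \<open>z\<^sub>g\<close>, one for each \<open>g \<in> R\<close> (\<open>branch_polys\<close>). A permutation of
\<open>R\<close> acts by permuting the variables. Substituting the branches for the variables turns \<open>Q\<close> into an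
analytic function near \<open>x\<^sub>0\<close>; sums and powers are respected, and the variable \<open>z\<^sub>g\<close> becomes the branch \<open>g\<close>.

Two facts then carry the proof.

\<^item> If \<open>Q\<close> is invariant under the monodromy group, then substituting the branches yields a rational
  function (\<open>monodromy_invariant_is_rational\<close>). By invariance the result of the substitution is
  single-valued on the complement of \<open>\<Sigma>\<close>. A power of the leading coefficient times a polynomial in the
  roots is bounded by a polynomial expression in the coefficients of the equation. On every complex line not
  contained in \<open>\<Sigma>\<close> the finitely many points of \<open>\<Sigma>\<close> are therefore removable singularities, and
  Liouville's theorem gives a polynomial of bounded degree. A function that is a polynomial of bounded
  degree in each variable separately is a polynomial, by Lagrange interpolation.

\<^item> If a solvable group \<open>H\<close> acts on the variables, every \<open>Q\<close> is obtained from \<open>H\<close>-invariant polynomials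
  by sums and root extractions (\<open>solvable_resolvents\<close>). For one permutation \<open>h\<close> with \<open>h\<^sup>m = 1\<close>, the
  polynomial \<open>Q\<close> is a sum of \<open>m\<close> eigenvectors of \<open>h\<close>, its Lagrange resolvents, whose \<open>m\<close>-th powers are
  fixed by \<open>h\<close>. If \<open>H/K\<close> is abelian, the elements of \<open>H\<close> can be adjoined one at a time to the
  permutations that fix a \<open>K\<close>-invariant polynomial: since they commute modulo \<open>K\<close>, the resolvents keep
  the invariance already present.

Finally, the germ that generates \<open>y\<close> can be continued to one of the branches at \<open>x\<^sub>0\<close>, because the
complement of \<open>\<Sigma>\<close> is dense and path connected: the line through any point and \<open>x\<^sub>0\<close> meets \<open>\<Sigma>\<close> in a
finite set.
\<close>

section \<open>Polynomials in several variables and the branch locus\<close>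

lemma mpoly_eval_superset:
  assumes "finite K" "Poly_Mapping.keys p \<subseteq> K"
  shows "mpoly_eval p x =
     (\<Sum>m\<in>K. Poly_Mapping.lookup p m * (\<Prod>i\<in>UNIV. vec_nth x i ^ Poly_Mapping.lookup m i))"
  unfolding mpoly_eval_def using assms
  by (intro sum.mono_neutral_left) (auto simp: in_keys_iff)

lemma mpoly_eval_0 [simp]: "mpoly_eval 0 x = 0"
  by (simp add: mpoly_eval_def)

lemma mpoly_eval_add: "mpoly_eval (p + q) x = mpoly_eval p x + mpoly_eval q x"
proof -
  let ?K = "Poly_Mapping.keys p \<union> Poly_Mapping.keys q"
  have "Poly_Mapping.keys (p + q) \<subseteq> ?K" by (rule keys_add)
  then show ?thesis
    by (simp add: mpoly_eval_superset[where K = ?K] lookup_add sum.distrib algebra_simps)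
qed

lemma mpoly_eval_sum: "mpoly_eval (\<Sum>a\<in>A. f a) x = (\<Sum>a\<in>A. mpoly_eval (f a) x)"
  by (induction A rule: infinite_finite_induct) (auto simp: mpoly_eval_add)

lemma mpoly_eval_single:
  "mpoly_eval (Poly_Mapping.single m c) x = c * (\<Prod>i\<in>UNIV. vec_nth x i ^ Poly_Mapping.lookup m i)"
  by (subst mpoly_eval_superset[where K = "{m}"]) auto

lemma mpoly_eq_sum_monomials:
  fixes p :: "'n mpoly"
  shows "p = (\<Sum>m\<in>Poly_Mapping.keys p. Poly_Mapping.single m (Poly_Mapping.lookup p m))"
  by (rule poly_mapping_eqI)
     (auto simp: lookup_sum lookup_single when_def sum.delta in_keys_iff)

lemma mpoly_eval_mult: "mpoly_eval (p * q) x = mpoly_eval p x * mpoly_eval q x"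
proof -
  let ?m = "\<lambda>p m. Poly_Mapping.single m (Poly_Mapping.lookup p m)"
  have "p * q = (\<Sum>m\<in>Poly_Mapping.keys p. ?m p m) * (\<Sum>m\<in>Poly_Mapping.keys q. ?m q m)"
    using mpoly_eq_sum_monomials[of p] mpoly_eq_sum_monomials[of q] by simp
  also have "\<dots> = (\<Sum>m\<in>Poly_Mapping.keys p. \<Sum>m'\<in>Poly_Mapping.keys q. ?m p m * ?m q m')"
    by (rule sum_product)
  finally have "mpoly_eval (p * q) x =
      (\<Sum>m\<in>Poly_Mapping.keys p. \<Sum>m'\<in>Poly_Mapping.keys q. mpoly_eval (?m p m * ?m q m') x)"
    by (simp add: mpoly_eval_sum)
  also have "\<dots> = (\<Sum>m\<in>Poly_Mapping.keys p. \<Sum>m'\<in>Poly_Mapping.keys q.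
      mpoly_eval (?m p m) x * mpoly_eval (?m q m') x)"
    by (intro sum.cong refl)
       (simp add: mult_single mpoly_eval_single lookup_add power_add prod.distrib)
  also have "\<dots> = (\<Sum>m\<in>Poly_Mapping.keys p. mpoly_eval (?m p m) x)
      * (\<Sum>m\<in>Poly_Mapping.keys q. mpoly_eval (?m q m) x)"
    by (rule sum_product[symmetric])
  also have "\<dots> = mpoly_eval p x * mpoly_eval q x"
    using mpoly_eq_sum_monomials[of p] mpoly_eq_sum_monomials[of q]
    by (simp flip: mpoly_eval_sum)
  finally show ?thesis .
qed

text \<open>
Working with the functions given by polynomials, rather than with the polynomials, lets closure
properties be used as introduction rules.
\<close>

definition polynomial_map :: "(complex ^ 'n::finite \<Rightarrow> complex) \<Rightarrow> bool" where
  "polynomial_map f \<longleftrightarrow> (\<exists>p. f = mpoly_eval p)"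

lemma polynomial_map_mpoly_eval [intro]: "polynomial_map (mpoly_eval p)"
  by (auto simp: polynomial_map_def)

lemma polynomial_map_const [intro]: "polynomial_map (\<lambda>x. c)"
  unfolding polynomial_map_def
  by (rule exI[of _ "Poly_Mapping.single 0 c"]) (auto simp: mpoly_eval_single)

lemma polynomial_map_component [intro]:
  fixes i :: "'n::finite"
  shows "polynomial_map (\<lambda>x. vec_nth x i)"
proof -
  have "(\<Prod>j\<in>UNIV. vec_nth x j ^ Poly_Mapping.lookup (Poly_Mapping.single i (1::nat)) j) = vec_nth x i"
    for x :: "complex ^ 'n"
  proof -
    have "(\<Prod>j\<in>UNIV. vec_nth x j ^ Poly_Mapping.lookup (Poly_Mapping.single i (1::nat)) j)
      = (\<Prod>j\<in>UNIV. if i = j then vec_nth x j else 1)"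
      by (intro prod.cong) (auto simp: lookup_single when_def)
    then show ?thesis by simp
  qed
  then have "(\<lambda>x. vec_nth x i) = mpoly_eval (Poly_Mapping.single (Poly_Mapping.single i 1) 1)"
    by (auto simp: mpoly_eval_single fun_eq_iff)
  then show ?thesis by (auto simp: polynomial_map_def)
qed

lemma polynomial_map_add [intro]:
  "\<lbrakk>polynomial_map f; polynomial_map g\<rbrakk> \<Longrightarrow> polynomial_map (\<lambda>x. f x + g x)"
  unfolding polynomial_map_def by (auto simp: fun_eq_iff mpoly_eval_add[symmetric])

lemma polynomial_map_mult [intro]:
  "\<lbrakk>polynomial_map f; polynomial_map g\<rbrakk> \<Longrightarrow> polynomial_map (\<lambda>x. f x * g x)"
  unfolding polynomial_map_def by (auto simp: fun_eq_iff mpoly_eval_mult[symmetric])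

lemma polynomial_map_power [intro]: "polynomial_map f \<Longrightarrow> polynomial_map (\<lambda>x. f x ^ k)"
  by (induction k) auto

lemma polynomial_map_sum [intro]:
  "(\<And>i. i \<in> I \<Longrightarrow> polynomial_map (f i)) \<Longrightarrow> polynomial_map (\<lambda>x. \<Sum>i\<in>I. f i x)"
  by (induction I rule: infinite_finite_induct) auto

definition restrict_to_line :: "complex ^ 'n::finite \<Rightarrow> complex ^ 'n \<Rightarrow> 'n mpoly \<Rightarrow> complex poly" where
  "restrict_to_line a v p = (\<Sum>m\<in>Poly_Mapping.keys p.
     Polynomial.smult (Poly_Mapping.lookup p m) (\<Prod>i\<in>UNIV. [:vec_nth a i, vec_nth v i:] ^ Poly_Mapping.lookup m i))"

lemma poly_restrict_to_line: "poly (restrict_to_line a v p) t = mpoly_eval p (a + t *s v)"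
  by (simp add: restrict_to_line_def mpoly_eval_def poly_sum poly_prod poly_power mult.commute)

text \<open>
The bound does not depend on the line. This uniformity is what makes a function that is a polynomial
on each coordinate line a polynomial of bounded degree in each variable.
\<close>

lemma degree_restrict_to_line_bounded:
  fixes p :: "'n::finite mpoly"
  shows "\<exists>d. \<forall>a v. degree (restrict_to_line a v p) \<le> d"
proof -
  define d where "d = (\<Sum>m\<in>Poly_Mapping.keys p. \<Sum>i\<in>(UNIV::'n set). Poly_Mapping.lookup m i)"
  have "degree (restrict_to_line a v p) \<le> d" for a v
    unfolding restrict_to_line_def
  proof (rule degree_sum_le)
    fix m assume m: "m \<in> Poly_Mapping.keys p"
    have "degree (Polynomial.smult (Poly_Mapping.lookup p m) (\<Prod>i\<in>UNIV. [:vec_nth a i, vec_nth v i:] ^ Poly_Mapping.lookup m i))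
       \<le> degree (\<Prod>i\<in>UNIV. [:vec_nth a i, vec_nth v i:] ^ Poly_Mapping.lookup m i)"
      by (rule degree_smult_le)
    also have "\<dots> \<le> (\<Sum>i\<in>UNIV. degree ([:vec_nth a i, vec_nth v i:] ^ Poly_Mapping.lookup m i))"
      by (rule order.trans[OF degree_prod_sum_le]) auto
    also have "\<dots> \<le> (\<Sum>i\<in>UNIV. Poly_Mapping.lookup m i)"
    proof (rule sum_mono)
      fix i
      have "degree ([:vec_nth a i, vec_nth v i:] ^ Poly_Mapping.lookup m i)
          \<le> degree [:vec_nth a i, vec_nth v i:] * Poly_Mapping.lookup m i"
        by (rule degree_power_le)
      also have "\<dots> \<le> 1 * Poly_Mapping.lookup m i"
        by (rule mult_right_mono) auto
      finally show "degree ([:vec_nth a i, vec_nth v i:] ^ Poly_Mapping.lookup m i) \<le> Poly_Mapping.lookup m i"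
        by simp
    qed
    also have "\<dots> \<le> d" unfolding d_def
      by (rule member_le_sum[OF m]) auto
    finally show "degree (Polynomial.smult (Poly_Mapping.lookup p m) (\<Prod>i\<in>UNIV. [:vec_nth a i, vec_nth v i:] ^ Poly_Mapping.lookup m i)) \<le> d" .
  qed auto
  then show ?thesis by blast
qed

lemma coeff_equation_at [simp]: "coeff (equation_at P x) i = mpoly_eval (coeff P i) x"
  by (simp add: equation_at_def coeff_map_poly)

lemma degree_equation_at_le: "degree (equation_at P x) \<le> degree P"
  by (rule degree_le) (auto simp: coeff_eq_0)

lemma degree_equation_at:
  "mpoly_eval (lead_coeff P) x \<noteq> 0 \<Longrightarrow> degree (equation_at P x) = degree P"
  by (metis coeff_equation_at degree_equation_at_le le_antisym le_degree)

lemma poly_as_sum_less: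
  fixes r :: "'a::comm_semiring_1 poly"
  assumes "r = 0 \<or> degree r < N"
  shows "poly r w = (\<Sum>k<N. coeff r k * w ^ k)"
proof -
  have "(\<Sum>k<N. coeff r k * w ^ k) = (\<Sum>k\<le>degree r. coeff r k * w ^ k)"
  proof (cases "r = 0")
    case False
    then show ?thesis using assms
      by (intro sum.mono_neutral_right) (auto simp: coeff_eq_0)
  qed simp
  then show ?thesis by (simp add: poly_altdef)
qed

lemma poly_equation_at:
  "poly (equation_at P x) w = (\<Sum>i\<le>degree P. mpoly_eval (coeff P i) x * w ^ i)"
  using poly_as_sum_less[of "equation_at P x" "Suc (degree P)" w] degree_equation_at_le[of P x]
  by (simp add: lessThan_Suc_atMost less_Suc_eq_le)

lemma not_branch_locus_iff:
  "x \<notin> branch_locus P \<longleftrightarrow> mpoly_eval (lead_coeff P) x \<noteq> 0 \<and>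
     resultant (equation_at P x) (pderiv (equation_at P x)) \<noteq> 0"
proof (cases "mpoly_eval (lead_coeff P) x = 0")
  case False
  then have "lead_coeff (equation_at P x) \<noteq> 0"
    by (simp add: degree_equation_at)
  with False show ?thesis by (simp add: branch_locus_def discriminant_def)
qed (simp add: branch_locus_def)


text \<open>
A common root \<open>w\<close> puts the vector of powers of \<open>w\<close> into the kernel of the Sylvester matrix: each row
lists the coefficients of a monomial multiple of \<open>p\<close> or \<open>q\<close>, and its product with the vector is the
value of that multiple at \<open>w\<close>.
\<close>

lemma common_root_imp_resultant_eq_0:
  fixes p q :: "'a::field poly"
  assumes p: "poly p w = 0" and q: "poly q w = 0" and deg: "0 < degree p + degree q"
  shows "resultant p q = 0"
proof -
  define m n where "m = degree p" and "n = degree q"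
  define v where "v = Matrix.vec (m + n) (\<lambda>j. w ^ (m + n - 1 - j))"
  let ?S = "sylvester_mat p q"
  have S: "?S \<in> carrier_mat (m + n) (m + n)"
    by (simp add: m_def n_def sylvester_carrier_mat)
  have vcarr: "v \<in> carrier_vec (m + n)" by (simp add: v_def)
  have row: "Matrix.row ?S i \<bullet> v = 0" if i: "i < m + n" for i
  proof -
    define s where "s = (if i < n then p else q)"
    \<comment> \<open>Row \<open>i\<close> holds the coefficients of \<open>X\<^sup>e s\<close>. In \<open>sylvester_index_mat2\<close> the exponents are larger by one.\<close>
    define e where "e = (if i < n then n - 1 - i else m + n - 1 - i)"
    have coeffs: "?S $$ (i, j) = coeff (Polynomial.monom 1 e * s) (m + n - 1 - j)" if j: "j < m + n" for j
    proof -
      have shift: "coeff (Polynomial.monom 1 (Suc e) * s) (m + n - j) =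
          coeff (Polynomial.monom 1 e * s) (m + n - 1 - j)"
      proof -
        from j obtain d where "m + n = Suc (j + d)" by (metis add_Suc_right less_imp_Suc_add)
        then show ?thesis by (simp add: coeff_monom_mult)
      qed
      have "?S $$ (i, j) = coeff (Polynomial.monom 1 (Suc e) * s) (m + n - j)"
        unfolding sylvester_index_mat2[OF i[unfolded m_def n_def] j[unfolded m_def n_def]]
        using i by (simp add: e_def s_def m_def n_def Suc_diff_Suc)
      with shift show ?thesis by simp
    qed
    have small: "Polynomial.monom 1 e * s = 0 \<or> degree (Polynomial.monom 1 e * s) < m + n"
    proof (cases "s = 0")
      case False
      then have "degree (Polynomial.monom 1 e * s) = e + degree s"
        by (subst degree_mult_eq) (auto simp: degree_monom_eq)
      also have "\<dots> < m + n"
        using i by (cases "i < n") (simp_all add: e_def s_def m_def n_def)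
      finally show ?thesis by simp
    qed simp
    have "Matrix.row ?S i \<bullet> v = (\<Sum>j<m+n. coeff (Polynomial.monom 1 e * s) (m + n - 1 - j) * w ^ (m + n - 1 - j))"
      using i S by (auto simp: scalar_prod_def v_def coeffs atLeast0LessThan m_def[symmetric] n_def[symmetric] intro!: sum.cong)
    also have "\<dots> = (\<Sum>k<m+n. coeff (Polynomial.monom 1 e * s) k * w ^ k)"
      by (subst sum.nat_diff_reindex[symmetric]) simp
    also have "\<dots> = poly (Polynomial.monom 1 e * s) w"
      using poly_as_sum_less[OF small] by simp
    also have "\<dots> = 0" using p q by (simp add: s_def)
    finally show ?thesis .
  qed
  have "?S *\<^sub>v v = 0\<^sub>v (m + n)"
    using S row by (intro eq_vecI) auto
  moreover have "v \<noteq> 0\<^sub>v (m + n)"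
  proof
    assume "v = 0\<^sub>v (m + n)"
    then have "vec_index v (m + n - 1) = 0" using deg by (simp add: m_def n_def)
    then show False using deg by (simp add: v_def m_def n_def)
  qed
  ultimately have "Determinant.det ?S = 0"
    using det_0_iff_vec_prod_zero_field[OF S] vcarr by blast
  then show ?thesis by (simp add: resultant_def)
qed

lemma outside_branch_locus_rsquarefree:
  assumes "x \<notin> branch_locus P"
  shows "rsquarefree (equation_at P x)"
  unfolding rsquarefree_roots
proof (intro allI notI)
  fix w assume w: "poly (equation_at P x) w = 0 \<and> poly (pderiv (equation_at P x)) w = 0"
  have lc: "mpoly_eval (lead_coeff P) x \<noteq> 0"
    using assms by (simp add: not_branch_locus_iff)
  show False
  proof (cases "degree (equation_at P x) = 0")
    case True
    then obtain c where "equation_at P x = [:c:]" by (metis degree_eq_zeroE)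
    with w have "equation_at P x = 0" by simp
    then have "coeff (equation_at P x) (degree P) = 0" by simp
    with lc show False by simp
  next
    case False
    then show False
      using common_root_imp_resultant_eq_0[of "equation_at P x" w "pderiv (equation_at P x)"] w assms
      by (simp add: not_branch_locus_iff)
  qed
qed

lemma card_roots_outside_branch_locus:
  assumes "x \<notin> branch_locus P"
  shows "card {w. poly (equation_at P x) w = 0} = degree P"
    and "finite {w. poly (equation_at P x) w = 0}"
    and "equation_at P x = Polynomial.smult (mpoly_eval (lead_coeff P) x)
           (\<Prod>w | poly (equation_at P x) w = 0. [:- w, 1:])"
proof -
  let ?p = "equation_at P x"
  have lc: "mpoly_eval (lead_coeff P) x \<noteq> 0"
    using assms by (simp add: not_branch_locus_iff)
  then have deg: "degree ?p = degree P" by (rule degree_equation_at)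
  have "coeff ?p (degree P) \<noteq> 0" using lc by simp
  then have nz: "?p \<noteq> 0" by force
  then show "finite {w. poly ?p w = 0}" by (rule poly_roots_finite)
  have dec: "Polynomial.smult (lead_coeff ?p) (\<Prod>z|poly ?p z = 0. [:-z, 1:]) = ?p"
    by (rule complex_poly_decompose_rsquarefree[OF outside_branch_locus_rsquarefree[OF assms]])
  then show "?p = Polynomial.smult (mpoly_eval (lead_coeff P) x) (\<Prod>w | poly ?p w = 0. [:- w, 1:])"
    by (simp add: deg)
  have "degree P = degree ?p" using deg by simp
  also have "\<dots> = degree (Polynomial.smult (lead_coeff ?p) (\<Prod>z|poly ?p z = 0. [:-z, 1:]))"
    by (simp only: dec)
  also have "\<dots> = card {w. poly ?p w = 0}"
    using lc by (simp add: degree_prod_eq_sum_degree deg)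
  finally show "card {w. poly ?p w = 0} = degree P" by simp
qed


lemma comm_ring_hom_mpoly_eval: "comm_ring_hom (\<lambda>p :: 'n::finite mpoly. mpoly_eval p x)"
  by unfold_locales (auto simp: mpoly_eval_add mpoly_eval_mult mpoly_eval_single simp flip: single_one)

text \<open>
Where the leading coefficient does not vanish, specialisation keeps the degrees of the equation and of its
derivative, hence commutes with the resultant. So \<open>P\<^sub>n\<close> times the resultant of \<open>P\<close> and its derivative over
the polynomial ring cuts out the branch locus.
\<close>

lemma branch_locus_hypersurface:
  fixes P :: "'n::{finite,linorder} mpoly poly"
  obtains D :: "'n mpoly" where "branch_locus P = {x. mpoly_eval D x = 0}"
proof -
  let ?D = "lead_coeff P * resultant P (pderiv P)"
  have "x \<notin> branch_locus P \<longleftrightarrow> mpoly_eval ?D x \<noteq> 0" for x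
  proof (cases "mpoly_eval (lead_coeff P) x = 0")
    case True
    then show ?thesis by (simp add: not_branch_locus_iff mpoly_eval_mult)
  next
    case False
    interpret ev: comm_ring_hom "\<lambda>p :: 'n mpoly. mpoly_eval p x" by (rule comm_ring_hom_mpoly_eval)
    let ?ev = "map_poly (\<lambda>p. mpoly_eval p x)"
    have deg: "degree (?ev P) = degree P"
      using degree_equation_at[OF False] by (simp add: equation_at_def)
    have pd: "pderiv (?ev P) = ?ev (pderiv P)"
      by (rule poly_eqI)
         (simp only: coeff_map_poly coeff_pderiv mpoly_eval_0 ev.hom_mult ev.hom_of_nat)
    have "degree (?ev (pderiv P)) = degree (pderiv P)"
      by (simp add: degree_pderiv deg flip: pd)
    from ev.resultant_map_poly[OF deg this] False show ?thesis
      by (simp add: not_branch_locus_iff mpoly_eval_mult pd equation_at_def)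
  qed
  then have "branch_locus P = {x. mpoly_eval ?D x = 0}" by blast
  then show ?thesis by (rule that)
qed

lemma finite_branch_locus_on_line:
  fixes P :: "'n::{finite,linorder} mpoly poly"
  assumes "a + s *s v \<notin> branch_locus P"
  shows "finite {t. a + t *s v \<in> branch_locus P}"
proof -
  obtain D where D: "branch_locus P = {x. mpoly_eval D x = 0}"
    by (rule branch_locus_hypersurface)
  have "poly (restrict_to_line a v D) s \<noteq> 0"
    using assms by (simp add: D poly_restrict_to_line)
  then have "restrict_to_line a v D \<noteq> 0" by (metis poly_0)
  then show ?thesis
    using poly_roots_finite[of "restrict_to_line a v D"] by (simp add: D poly_restrict_to_line)
qed

section \<open>Complex differentiability in several variables\<close>

lemma isCont_imp_tendsto_nhds: "isCont f z \<Longrightarrow> (f \<longlongrightarrow> f z) (nhds z)"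
  unfolding isCont_def by (rule tendsto_at_iff_tendsto_nhds[THEN iffD1])

definition complex_diff_at :: "(complex ^ 'n::finite \<Rightarrow> complex) \<Rightarrow> complex ^ 'n \<Rightarrow> bool" where
  "complex_diff_at f z \<longleftrightarrow> (\<exists>f'. (f has_derivative f') (at z) \<and> (\<forall>c v. f' (c *s v) = c * f' v))"

lemma holomorphic_several_iff: "holomorphic_several f U \<longleftrightarrow> (\<forall>z\<in>U. complex_diff_at f z)"
  by (simp add: holomorphic_several_def complex_diff_at_def)

lemma holomorphic_several_subset:
  "\<lbrakk>holomorphic_several f U; V \<subseteq> U\<rbrakk> \<Longrightarrow> holomorphic_several f V"
  by (auto simp: holomorphic_several_iff)

lemma complex_diff_at_imp_isCont: "complex_diff_at f z \<Longrightarrow> isCont f z"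
  by (auto simp: complex_diff_at_def intro: has_derivative_continuous)

lemma complex_diff_at_cong:
  assumes "complex_diff_at f z" "\<forall>\<^sub>F x in nhds z. g x = f x"
  shows "complex_diff_at g z"
proof -
  from assms(1) obtain f' where f': "(f has_derivative f') (at z)" "\<And>c v. f' (c *s v) = c * f' v"
    by (auto simp: complex_diff_at_def)
  have ev: "\<forall>\<^sub>F x in at z. f x = g x"
    using assms(2) by (auto simp: eventually_at_filter elim: eventually_mono)
  have "f z = g z" using eventually_nhds_x_imp_x[OF assms(2)] by simp
  from has_derivative_transform_eventually[OF f'(1) ev this] have "(g has_derivative f') (at z)"
    by simp
  with f'(2) show ?thesis by (auto simp: complex_diff_at_def)
qed

lemma complex_diff_at_const [intro, simp]: "complex_diff_at (\<lambda>x. c) z"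
  unfolding complex_diff_at_def by (rule exI[of _ "\<lambda>_. 0"]) auto

lemma complex_diff_at_component [intro, simp]: "complex_diff_at (\<lambda>x. vec_nth x i) z"
  unfolding complex_diff_at_def
  by (rule exI[of _ "\<lambda>x. vec_nth x i"])
     (auto intro!: bounded_linear.has_derivative[OF bounded_linear_vec_nth] has_derivative_ident)

lemma complex_diff_at_add [intro]:
  assumes "complex_diff_at f z" "complex_diff_at g z"
  shows "complex_diff_at (\<lambda>x. f x + g x) z"
proof -
  from assms obtain f' g' where "(f has_derivative f') (at z)" "\<And>c v. f' (c *s v) = c * f' v"
    "(g has_derivative g') (at z)" "\<And>c v. g' (c *s v) = c * g' v"
    by (auto simp: complex_diff_at_def)
  then show ?thesis unfolding complex_diff_at_def
    by (intro exI[of _ "\<lambda>x. f' x + g' x"]) (auto simp: algebra_simps intro!: has_derivative_add)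
qed

lemma complex_diff_at_mult [intro]:
  assumes "complex_diff_at f z" "complex_diff_at g z"
  shows "complex_diff_at (\<lambda>x. f x * g x) z"
proof -
  from assms obtain f' g' where "(f has_derivative f') (at z)" "\<And>c v. f' (c *s v) = c * f' v"
    "(g has_derivative g') (at z)" "\<And>c v. g' (c *s v) = c * g' v"
    by (auto simp: complex_diff_at_def)
  then show ?thesis unfolding complex_diff_at_def
    by (intro exI[of _ "\<lambda>x. f z * g' x + f' x * g z"])
       (auto simp: algebra_simps intro!: has_derivative_mult[THEN has_derivative_eq_rhs])
qed

lemma complex_diff_at_power [intro]: "complex_diff_at f z \<Longrightarrow> complex_diff_at (\<lambda>x. f x ^ k) z"
  by (induction k) auto

lemma complex_diff_at_sum [intro]:
  "(\<And>i. i \<in> I \<Longrightarrow> complex_diff_at (f i) z) \<Longrightarrow> complex_diff_at (\<lambda>x. \<Sum>i\<in>I. f i x) z"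
  by (induction I rule: infinite_finite_induct) auto

lemma complex_diff_at_prod [intro]:
  "(\<And>i. i \<in> I \<Longrightarrow> complex_diff_at (f i) z) \<Longrightarrow> complex_diff_at (\<lambda>x. \<Prod>i\<in>I. f i x) z"
  by (induction I rule: infinite_finite_induct) auto

lemma complex_diff_at_mpoly_eval [intro, simp]: "complex_diff_at (mpoly_eval p) z"
  unfolding mpoly_eval_def[abs_def] by (intro complex_diff_at_sum complex_diff_at_mult complex_diff_at_prod complex_diff_at_power) auto

lemma isCont_mpoly_eval [simp]: "isCont (mpoly_eval p) z"
  by (rule complex_diff_at_imp_isCont) simp

text \<open>
A factor that is merely continuous does no harm where the other factor vanishes. This gives the
derivative of an implicitly defined function without an implicit function theorem.
\<close>

lemma complex_diff_at_mult_vanishing: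
  assumes N: "complex_diff_at N z" "N z = 0" and c: "isCont c z"
  shows "complex_diff_at (\<lambda>x. N x * c x) z"
proof -
  from N obtain N' where N': "(N has_derivative N') (at z)" "\<And>c v. N' (c *s v) = c * N' v"
    by (auto simp: complex_diff_at_def)
  have "((\<lambda>x. N x * c x) has_derivative (\<lambda>v. N' v * c z)) (at z)"
    unfolding has_derivative_iff_norm
  proof
    show "bounded_linear (\<lambda>v. N' v * c z)"
      using has_derivative_bounded_linear[OF N'(1)] by (rule bounded_linear_mult_const)
    have lim: "((\<lambda>y. norm (N y - N' (y - z)) / norm (y - z)) \<longlongrightarrow> 0) (at z)"
      using N'(1) by (simp add: has_derivative_iff_norm N(2))
    obtain K where K: "\<And>v. norm (N' v) \<le> norm v * K"
      using bounded_linear.bounded[OF has_derivative_bounded_linear[OF N'(1)]] by blast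
    have c0: "((\<lambda>y. norm (c y - c z)) \<longlongrightarrow> 0) (at z)"
      using c by (simp add: isCont_def LIM_zero tendsto_norm_zero)
    have cn: "((\<lambda>y. norm (c y)) \<longlongrightarrow> norm (c z)) (at z)"
      using c by (simp add: isCont_def tendsto_norm)
    have bnd: "norm (N y * c y - N z * c z - N' (y - z) * c z) / norm (y - z)
        \<le> norm (N y - N' (y - z)) / norm (y - z) * norm (c y) + K * norm (c y - c z)"
      if "y \<noteq> z" for y
    proof -
      have "norm (N y * c y - N z * c z - N' (y - z) * c z)
          = norm ((N y - N' (y - z)) * c y + N' (y - z) * (c y - c z))"
        by (simp add: N(2) algebra_simps)
      also have "\<dots> \<le> norm (N y - N' (y - z)) * norm (c y) + norm (N' (y - z)) * norm (c y - c z)"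
        by (rule order.trans[OF norm_triangle_ineq]) (simp add: norm_mult)
      also have "\<dots> \<le> norm (N y - N' (y - z)) * norm (c y) + norm (y - z) * K * norm (c y - c z)"
        by (intro add_left_mono mult_right_mono K) auto
      finally show ?thesis using that by (simp add: field_simps)
    qed
    show "((\<lambda>y. norm (N y * c y - N z * c z - N' (y - z) * c z) / norm (y - z)) \<longlongrightarrow> 0) (at z)"
    proof (rule tendsto_sandwich[of "\<lambda>_. 0"])
      show "((\<lambda>y. norm (N y - N' (y - z)) / norm (y - z) * norm (c y) + K * norm (c y - c z)) \<longlongrightarrow> 0) (at z)"
        using tendsto_add[OF tendsto_mult[OF lim cn] tendsto_mult_left[OF c0, of K]] by simp
      show "\<forall>\<^sub>F y in at z. norm (N y * c y - N z * c z - N' (y - z) * c z) / norm (y - z)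
        \<le> norm (N y - N' (y - z)) / norm (y - z) * norm (c y) + K * norm (c y - c z)"
        using bnd by (auto simp: eventually_at_filter)
    qed auto
  qed
  with N'(2) show ?thesis unfolding complex_diff_at_def by (auto intro!: exI[of _ "\<lambda>v. N' v * c z"])
qed

lemma complex_diff_at_on_line:
  assumes "complex_diff_at f (a + t *s v)"
  shows "(\<lambda>t. f (a + t *s v)) field_differentiable at t"
proof -
  from assms obtain f' where f': "(f has_derivative f') (at (a + t *s v))" "\<And>c v. f' (c *s v) = c * f' v"
    by (auto simp: complex_diff_at_def)
  have lin: "((\<lambda>t. t *s v) has_derivative (\<lambda>t. t *s v)) (at t)"
  proof -
    have "bounded_linear (\<lambda>t. t *s v)"
      by (rule linear_conv_bounded_linear[THEN iffD1], rule linearI)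
         (simp_all add: Finite_Cartesian_Product.vec_eq_iff ring_distribs)
    then show ?thesis by (rule bounded_linear_imp_has_derivative)
  qed
  have "((\<lambda>t. a + t *s v) has_derivative (\<lambda>t. t *s v)) (at t)"
    using has_derivative_add[OF has_derivative_const[of a] lin] by simp
  from has_derivative_compose[OF this f'(1)]
  have "((\<lambda>t. f (a + t *s v)) has_derivative (\<lambda>s. s * f' v)) (at t)"
    by (simp add: f'(2))
  moreover have flip_mult: "(*) (f' v) = (\<lambda>s. s * f' v)" by (simp add: fun_eq_iff)
  ultimately show ?thesis
    unfolding field_differentiable_def has_field_derivative_def
    by (intro exI[of _ "f' v"]) (simp add: flip_mult)
qed

text \<open>
The identity theorem reduces to one variable: the complex line through \<open>b\<close> and \<open>z\<close> meets a convex open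
set in a convex, hence connected, open set of parameters.
\<close>

lemma identity_on_convex:
  assumes U: "open U" "convex U" and f: "holomorphic_several f U" and g: "holomorphic_several g U"
    and b: "b \<in> U" and eq: "\<forall>\<^sub>F x in nhds b. f x = g x" and z: "z \<in> U"
  shows "f z = g z"
proof -
  define T where "T = {t. b + t *s (z - b) \<in> U}"
  let ?F = "\<lambda>t. f (b + t *s (z - b)) - g (b + t *s (z - b))"
  have cont: "continuous_on UNIV (\<lambda>t :: complex. b + t *s (z - b))"
    by (intro continuous_intros continuous_on_vec_lambda) (auto simp: vector_scalar_mult_def intro!: continuous_intros)
  have opT: "open T"
    using open_vimage[OF U(1) cont] by (simp add: T_def vimage_def)
  have comb: "b + ((1 - u) *\<^sub>R t + u *\<^sub>R s) *s (z - b) =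
     (1 - u) *\<^sub>R (b + t *s (z - b)) + u *\<^sub>R (b + s *s (z - b))" for u and t s :: complex
    by (simp add: Finite_Cartesian_Product.vec_eq_iff) (simp add: scaleR_conv_of_real ring_distribs)
  have "convex T"
    unfolding convex_alt
  proof (intro ballI allI impI)
    fix t s and u :: real assume "t \<in> T" "s \<in> T" "0 \<le> u \<and> u \<le> 1"
    then show "(1 - u) *\<^sub>R t + u *\<^sub>R s \<in> T"
      using U(2) unfolding convex_alt T_def mem_Collect_eq comb by blast
  qed
  then have conT: "connected T" by (rule convex_connected)
  have "?F holomorphic_on T"
    unfolding holomorphic_on_def
  proof
    fix t assume "t \<in> T"
    then have "complex_diff_at f (b + t *s (z - b))" "complex_diff_at g (b + t *s (z - b))"
      using f g by (simp_all only: holomorphic_several_iff T_def mem_Collect_eq)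
    from field_differentiable_diff[OF this[THEN complex_diff_at_on_line]]
    show "?F field_differentiable at t within T" by (rule field_differentiable_at_within)
  qed
  moreover obtain W where W: "open W" "b \<in> W" "\<And>x. x \<in> W \<Longrightarrow> f x = g x"
    using eq by (auto simp: eventually_nhds)
  define V where "V = T \<inter> {t. b + t *s (z - b) \<in> W}"
  have opV: "open V" unfolding V_def
    using opT open_vimage[OF W(1) cont] by (auto simp: vimage_def)
  have 0: "0 \<in> V" using b W by (simp add: V_def T_def)
  have lim: "0 islimpt V"
    using open_imp_islimpt[OF opV 0] .
  have "1 \<in> T" using z by (simp add: T_def)
  ultimately have "?F 1 = 0"
    using analytic_continuation[OF _ opT conT, of ?F V 0 1] lim 0 W(3) by (auto simp: V_def)
  then show ?thesis by simp
qed

section \<open>The branches outside the branch locus\<close>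

text \<open>
If all roots at \<open>x\<close> kept distance \<open>e\<close> from \<open>w\<close>, the factorisation of the equation would give
\<open>\<bar>P(x, w)\<bar> \<ge> \<bar>P\<^sub>n(x)\<bar> e\<^sup>n\<close>. As \<open>x\<close> tends to \<open>z\<close>,
the left side tends to \<open>0\<close> and the right side does not.
\<close>

lemma roots_persist:
  fixes P :: "'n::{finite,linorder} mpoly poly"
  assumes z: "z \<notin> branch_locus P" and w: "poly (equation_at P z) w = 0" and e: "e > 0"
  shows "\<forall>\<^sub>F x in nhds z. \<exists>w'. poly (equation_at P x) w' = 0 \<and> dist w w' < e"
proof -
  let ?l = "mpoly_eval (lead_coeff P)"
  obtain D where D: "branch_locus P = {x. mpoly_eval D x = 0}" by (rule branch_locus_hypersurface)
  have "\<forall>\<^sub>F x in nhds z. mpoly_eval D x \<in> - {0}"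
    by (rule topological_tendstoD[OF isCont_mpoly_eval[of z D, THEN isCont_imp_tendsto_nhds]])
       (use z D in auto)
  then have ev1: "\<forall>\<^sub>F x in nhds z. x \<notin> branch_locus P" by (simp add: D)
  let ?h = "\<lambda>x. cmod (?l x) * e ^ degree P - cmod (poly (equation_at P x) w)"
  have "isCont ?h z"
    unfolding poly_equation_at by (intro continuous_intros isCont_mpoly_eval)
  then have lim: "(?h \<longlongrightarrow> ?h z) (nhds z)"
    by (rule isCont_imp_tendsto_nhds)
  have "?h z > 0"
    using z e w by (simp add: not_branch_locus_iff)
  from order_tendstoD(1)[OF lim this] have "\<forall>\<^sub>F x in nhds z. ?h x > 0" .
  with ev1 show ?thesis
  proof eventually_elim
    case (elim x)
    let ?p = "equation_at P x"
    show ?case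
    proof (rule ccontr)
      assume no: "\<not> ?thesis"
      note roots = card_roots_outside_branch_locus[OF elim(1)]
      have "cmod (?l x) * e ^ degree P = cmod (?l x) * (\<Prod>w' | poly ?p w' = 0. e)"
        by (simp add: roots(1))
      also have "\<dots> \<le> cmod (?l x) * (\<Prod>w' | poly ?p w' = 0. cmod (w - w'))"
        using no e by (intro mult_left_mono prod_mono) (auto simp: dist_norm not_less)
      also have "\<dots> = cmod (poly (Polynomial.smult (?l x) (\<Prod>w' | poly ?p w' = 0. [:- w', 1:])) w)"
        by (simp add: norm_mult poly_prod prod_norm)
      also have "\<dots> = cmod (poly ?p w)"
        by (simp only: roots(3)[symmetric])
      finally show False using elim(2) by simp
    qed
  qed
qed

text \<open>
With \<open>w = f z\<close>, the difference \<open>P(x, f x) - P(x, w)\<close> is \<open>(f x - w) q(x)\<close>, where \<open>q\<close> is continuous at \<open>z\<close> and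
\<open>q(z)\<close> is the derivative of the equation at its simple root \<open>w\<close>. Hence \<open>f x - w = - P(x, w) / q(x)\<close>
near \<open>z\<close>, where the numerator is a polynomial in \<open>x\<close> that vanishes at \<open>z\<close>.
\<close>

lemma continuous_root_complex_diff_at:
  fixes P :: "'n::{finite,linorder} mpoly poly"
  assumes z: "z \<notin> branch_locus P" and f: "isCont f z"
    and root: "\<forall>\<^sub>F x in nhds z. poly (equation_at P x) (f x) = 0"
  shows "complex_diff_at f z"
proof -
  let ?w = "f z"
  let ?c = "\<lambda>i x. mpoly_eval (coeff P i) x"
  define q where "q x = (\<Sum>i\<le>degree P. ?c i x * (\<Sum>j<i. ?w ^ (i - Suc j) * f x ^ j))" for x
  define N where "N x = - poly (equation_at P x) ?w" for x
  have diff: "poly (equation_at P x) (f x) + N x = (f x - ?w) * q x" for x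
  proof -
    have "poly (equation_at P x) (f x) + N x = (\<Sum>i\<le>degree P. ?c i x * (f x ^ i - ?w ^ i))"
      by (simp add: N_def poly_equation_at right_diff_distrib sum_subtractf)
    also have "\<dots> = (\<Sum>i\<le>degree P. ?c i x * ((f x - ?w) * (\<Sum>j<i. ?w ^ (i - Suc j) * f x ^ j)))"
      by (simp only: power_diff_sumr2)
    also have "\<dots> = (f x - ?w) * q x"
      unfolding q_def by (subst sum_distrib_left) (intro sum.cong refl mult.left_commute)
    finally show ?thesis .
  qed
  have contq: "isCont q z" unfolding q_def by (intro continuous_intros isCont_mpoly_eval f)
  have rootz: "poly (equation_at P z) ?w = 0" using eventually_nhds_x_imp_x[OF root] .
  have "q z = poly (pderiv (equation_at P z)) ?w"
  proof -
    have "q z = (\<Sum>i\<le>degree P. ?c i z * (of_nat i * ?w ^ (i - 1)))"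
      unfolding q_def
    proof (intro sum.cong refl arg_cong2[where f = "(*)"])
      fix i
      have "(\<Sum>j<i. ?w ^ (i - Suc j) * ?w ^ j) = (\<Sum>j<i. ?w ^ (i - 1))"
        by (intro sum.cong) (auto simp flip: power_add)
      then show "(\<Sum>j<i. ?w ^ (i - Suc j) * ?w ^ j) = of_nat i * ?w ^ (i - 1)" by simp
    qed
    also have "\<dots> = poly (pderiv (equation_at P z)) ?w"
    proof -
      have "poly (pderiv (equation_at P z)) ?w = (\<Sum>i<degree P. coeff (pderiv (equation_at P z)) i * ?w ^ i)"
      proof (cases "degree P = 0")
        case True
        then have "degree (equation_at P z) = 0" using degree_equation_at_le[of P z] by simp
        then have "pderiv (equation_at P z) = 0" by (simp add: pderiv_eq_0_iff)
        then show ?thesis by simp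
      next
        case False
        then show ?thesis
          using degree_equation_at_le[of P z] by (intro poly_as_sum_less) (auto simp: degree_pderiv)
      qed
      also have "\<dots> = (\<Sum>i<degree P. ?c (Suc i) z * (of_nat (Suc i) * ?w ^ i))"
        by (intro sum.cong) (auto simp: coeff_pderiv)
      also have "\<dots> = (\<Sum>i\<le>degree P. ?c i z * (of_nat i * ?w ^ (i - 1)))"
        by (simp add: sum.atMost_shift)
      finally show ?thesis by simp
    qed
    finally show ?thesis .
  qed
  also have "\<dots> \<noteq> 0"
    using outside_branch_locus_rsquarefree[OF z] rootz by (auto simp: rsquarefree_roots)
  finally have qz: "q z \<noteq> 0" .
  have "\<forall>\<^sub>F x in nhds z. q x \<in> - {0}"
    by (rule topological_tendstoD[OF contq[THEN isCont_imp_tendsto_nhds]]) (use qz in auto)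
  with root have ev: "\<forall>\<^sub>F x in nhds z. f x = ?w + N x * inverse (q x)"
  proof eventually_elim
    case (elim x)
    then show ?case using diff[of x] by (simp add: field_simps)
  qed
  have "complex_diff_at (\<lambda>x. ?w + N x * inverse (q x)) z"
  proof (intro complex_diff_at_add complex_diff_at_const complex_diff_at_mult_vanishing)
    have "complex_diff_at (\<lambda>x. (-1) * poly (equation_at P x) ?w) z"
      unfolding poly_equation_at by (intro complex_diff_at_mult complex_diff_at_sum complex_diff_at_const complex_diff_at_mpoly_eval)
    then show "complex_diff_at N z" by (simp add: N_def[abs_def])
    show "N z = 0" using rootz by (simp add: N_def)
    show "isCont (\<lambda>x. inverse (q x)) z" using contq qz by (intro continuous_intros)
  qed
  then show ?thesis using ev by (rule complex_diff_at_cong)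
qed

lemma finite_separated:
  fixes W :: "'a::metric_space set"
  assumes "finite W"
  obtains e where "e > 0" "\<And>u v. \<lbrakk>u \<in> W; v \<in> W; u \<noteq> v\<rbrakk> \<Longrightarrow> 2 * e \<le> dist u v"
proof -
  define D where "D = insert 1 {dist u v | u v. u \<in> W \<and> v \<in> W \<and> u \<noteq> v}"
  have "finite D"
  proof -
    have "D \<subseteq> insert 1 ((\<lambda>(u, v). dist u v) ` (W \<times> W))" by (auto simp: D_def)
    then show ?thesis using assms by (meson finite_SigmaI finite_imageI finite_insert finite_subset)
  qed
  moreover have "D \<noteq> {}" by (simp add: D_def)
  moreover have "d > 0" if "d \<in> D" for d using that by (auto simp: D_def)
  ultimately have "Min D > 0" "\<And>d. d \<in> D \<Longrightarrow> Min D \<le> d" by auto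
  then show ?thesis
    by (intro that[of "Min D / 2"]) (auto simp: D_def)
qed

text \<open>
Around the \<open>n\<close> distinct roots at \<open>x\<close> there are disjoint discs. For \<open>z\<close> near \<open>x\<close> each of them contains a
root at \<open>z\<close>, and there are only \<open>n\<close> roots, so each contains exactly one. This root is a continuous function
of \<open>z\<close>, hence holomorphic.
\<close>

lemma local_branches:
  fixes P :: "'n::{finite,linorder} mpoly poly"
  assumes x: "x \<notin> branch_locus P"
  obtains r Bs where "r > 0" "ball x r \<inter> branch_locus P = {}" "finite Bs"
    "\<And>f. f \<in> Bs \<Longrightarrow> holomorphic_several f (ball x r)"
    "\<And>z. z \<in> ball x r \<Longrightarrow> bij_betw (\<lambda>f. f z) Bs {w. poly (equation_at P z) w = 0}"
proof -
  let ?root = "\<lambda>z w. poly (equation_at P z) w = 0"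
  define W where "W = {w. ?root x w}"
  have finW: "finite W" and cardW: "card W = degree P"
    using card_roots_outside_branch_locus[OF x] by (simp_all add: W_def)
  obtain e where e: "e > 0" and sep: "\<And>u v. \<lbrakk>u \<in> W; v \<in> W; u \<noteq> v\<rbrakk> \<Longrightarrow> 2 * e \<le> dist u v"
    using finite_separated[OF finW] by metis
  obtain D where D: "branch_locus P = {x. mpoly_eval D x = 0}" by (rule branch_locus_hypersurface)
  have "\<forall>\<^sub>F z in nhds x. mpoly_eval D z \<in> - {0}"
    by (rule topological_tendstoD[OF isCont_mpoly_eval[of x D, THEN isCont_imp_tendsto_nhds]])
       (use x D in auto)
  then have "\<forall>\<^sub>F z in nhds x. z \<notin> branch_locus P" by (simp add: D)
  moreover have "\<forall>\<^sub>F z in nhds x. \<forall>w\<in>W. \<exists>w'. ?root z w' \<and> dist w w' < e"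
    using finW roots_persist[OF x _ e] by (intro eventually_ball_finite) (auto simp: W_def)
  ultimately have "\<forall>\<^sub>F z in nhds x. z \<notin> branch_locus P \<and> (\<forall>w\<in>W. \<exists>w'. ?root z w' \<and> dist w w' < e)"
    by (rule eventually_conj)
  then obtain r where r: "r > 0"
    and r': "\<And>z. z \<in> ball x r \<Longrightarrow> z \<notin> branch_locus P \<and> (\<forall>w\<in>W. \<exists>w'. ?root z w' \<and> dist w w' < e)"
    unfolding eventually_nhds_metric by (auto simp: dist_commute)
  define f where "f w z = (SOME w'. ?root z w' \<and> dist w w' < e)" for w z
  have f: "?root z (f w z) \<and> dist w (f w z) < e" if "z \<in> ball x r" "w \<in> W" for w z
  proof -
    have "\<exists>w'. ?root z w' \<and> dist w w' < e" using r'[OF that(1)] that(2) by blast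
    then show ?thesis unfolding f_def by (rule someI_ex)
  qed
  have same: "u = v" if "u \<in> W" "v \<in> W" "dist u w < e" "dist v w < e" for u v w
  proof (rule ccontr)
    assume "u \<noteq> v"
    then have "2 * e \<le> dist u v" using sep that by auto
    with that dist_triangle2[of u v w] show False by simp
  qed
  have inj: "inj_on (\<lambda>w. f w z) W" if "z \<in> ball x r" for z
  proof (rule inj_onI)
    fix u v assume uv: "u \<in> W" "v \<in> W" "f u z = f v z"
    then show "u = v" using f[OF that uv(1)] f[OF that uv(2)] by (intro same[of u v "f u z"]) auto
  qed
  have img: "(\<lambda>w. f w z) ` W = {w. ?root z w}" if z: "z \<in> ball x r" for z
  proof (rule card_subset_eq)
    have zn: "z \<notin> branch_locus P" using r'[OF z] by blast
    show "finite {w. ?root z w}" using card_roots_outside_branch_locus(2)[OF zn] .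
    show "(\<lambda>w. f w z) ` W \<subseteq> {w. ?root z w}" using f[OF z] by auto
    show "card ((\<lambda>w. f w z) ` W) = card {w. ?root z w}"
      using card_image[OF inj[OF z]] cardW card_roots_outside_branch_locus(1)[OF zn] by simp
  qed
  have uniq: "w' = f w z" if z: "z \<in> ball x r" and w: "w \<in> W" and w': "?root z w'" "dist w w' < e" for w w' z
  proof -
    obtain v where v: "v \<in> W" "w' = f v z" using img[OF z] w'(1) by blast
    with f[OF z v(1)] same[of v w w'] w w' show ?thesis by auto
  qed
  have hol: "holomorphic_several (f w) (ball x r)" if w: "w \<in> W" for w
    unfolding holomorphic_several_iff
  proof
    fix z assume z: "z \<in> ball x r"
    have zn: "z \<notin> branch_locus P" using r'[OF z] by blast
    have near: "\<forall>\<^sub>F y in nhds z. y \<in> ball x r"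
      using z by (intro eventually_nhds_in_open) auto
    have "\<forall>\<^sub>F y in nhds z. dist (f w y) (f w z) < d" if "d > 0" for d
    proof -
      \<comment> \<open>Small enough for the disc around \<open>f w z\<close> to stay in the disc around \<open>w\<close>, which contains no second root.\<close>
      define d' where "d' = min d (e - dist w (f w z))"
      have "d' > 0" using f[OF z w] that by (simp add: d'_def)
      with f[OF z w] have "\<forall>\<^sub>F y in nhds z. \<exists>w'. ?root y w' \<and> dist (f w z) w' < d'"
        using roots_persist[OF zn] by blast
      with near show ?thesis
      proof eventually_elim
        case (elim y)
        then obtain w' where w': "?root y w'" "dist (f w z) w' < d'" by blast
        have "dist w w' < e"
          using w'(2) dist_triangle[of w w' "f w z"] by (simp add: d'_def)
        from uniq[OF elim(1) w w'(1) this] w'(2) show ?case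
          by (simp add: d'_def dist_commute)
      qed
    qed
    then have "(f w \<longlongrightarrow> f w z) (nhds z)" by (rule tendstoI)
    then have "isCont (f w) z"
      unfolding isCont_def by (rule tendsto_at_iff_tendsto_nhds[THEN iffD2])
    moreover have "\<forall>\<^sub>F y in nhds z. ?root y (f w y)"
      using near by eventually_elim (use f w in auto)
    ultimately show "complex_diff_at (f w) z"
      by (rule continuous_root_complex_diff_at[OF zn])
  qed
  show ?thesis
  proof (rule that[of r "f ` W"])
    show "ball x r \<inter> branch_locus P = {}" using r' by auto
    show "bij_betw (\<lambda>g. g z) (f ` W) {w. ?root z w}" if z: "z \<in> ball x r" for z
      unfolding bij_betw_def
      using img[OF z] inj[OF z] by (auto simp: inj_on_def image_image)
  qed (use r finW hol in auto)
qed

section \<open>Germs and their continuation\<close>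

lemma germ_at_eq_iff:
  "germ_at a f = germ_at b g \<longleftrightarrow> a = b \<and> (\<forall>\<^sub>F x in nhds a. f x = g x)"
proof
  assume eq: "germ_at a f = germ_at b g"
  then have "a = b" by (simp add: germ_at_def)
  moreover have "f \<in> snd (germ_at a f)" by (simp add: germ_at_def)
  with eq have "f \<in> snd (germ_at b g)" by simp
  ultimately show "a = b \<and> (\<forall>\<^sub>F x in nhds a. f x = g x)" by (simp add: germ_at_def)
next
  assume "a = b \<and> (\<forall>\<^sub>F x in nhds a. f x = g x)"
  then have ab: "a = b" and ev: "\<forall>\<^sub>F x in nhds b. f x = g x" by auto
  have "(\<forall>\<^sub>F x in nhds b. h x = f x) \<longleftrightarrow> (\<forall>\<^sub>F x in nhds b. h x = g x)" for h
    by (rule eventually_cong[OF ev]) auto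
  then show "germ_at a f = germ_at b g" by (simp add: germ_at_def ab)
qed

text \<open>
All representatives of a germ agree at its base point, so any choice will do.
\<close>

definition germ_value :: "'n::finite germ \<Rightarrow> complex" where
  "germ_value g = (SOME f. f \<in> snd g) (fst g)"

lemma germ_value_germ_at [simp]: "germ_value (germ_at a f) = f a"
proof -
  let ?h = "SOME h. \<forall>\<^sub>F x in nhds a. h x = f x"
  have "\<forall>\<^sub>F x in nhds a. ?h x = f x" by (rule someI[of _ f]) simp
  then have "?h a = f a" by (rule eventually_nhds_x_imp_x)
  then show ?thesis by (simp add: germ_value_def germ_at_def)
qed

lemma fst_germ_at [simp]: "fst (germ_at a f) = a"
  by (simp add: germ_at_def)

text \<open>
A continuous solution cannot jump between the local branches, whose values at each point are distinct.
\<close>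

lemma solution_germs_local:
  fixes P :: "'n::{finite,linorder} mpoly poly"
  assumes hol: "\<And>f. f \<in> Bs \<Longrightarrow> holomorphic_several f (ball x r)" and fin: "finite Bs"
    and bij: "\<And>z. z \<in> ball x r \<Longrightarrow> bij_betw (\<lambda>f. f z) Bs {w. poly (equation_at P z) w = 0}"
    and z: "z \<in> ball x r"
  shows "solution_germs P z = germ_at z ` Bs"
proof (intro equalityI subsetI)
  have near: "\<forall>\<^sub>F y in nhds z. y \<in> ball x r"
    using z by (intro eventually_nhds_in_open) auto
  {
    fix g assume "g \<in> germ_at z ` Bs"
    then obtain f where f: "f \<in> Bs" "g = germ_at z f" by blast
    have "\<forall>\<^sub>F y in nhds z. poly (equation_at P y) (f y) = 0"
      using near by eventually_elim (use bij f(1) in \<open>auto simp: bij_betw_def\<close>)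
    moreover have "analytic_near f z"
      unfolding analytic_near_def using hol[OF f(1)] z by (intro exI[of _ "ball x r"]) auto
    ultimately show "g \<in> solution_germs P z" by (auto simp: solution_germs_def f(2))
  }
  fix g assume "g \<in> solution_germs P z"
  then obtain h where h: "g = germ_at z h" "analytic_near h z"
    "\<forall>\<^sub>F y in nhds z. poly (equation_at P y) (h y) = 0"
    by (auto simp: solution_germs_def)
  have "isCont h z"
    using h(2) by (auto simp: analytic_near_def holomorphic_several_iff intro: complex_diff_at_imp_isCont)
  then have hz: "(h \<longlongrightarrow> h z) (nhds z)" by (rule isCont_imp_tendsto_nhds)
  have "h z \<in> (\<lambda>f. f z) ` Bs"
    using bij[OF z] eventually_nhds_x_imp_x[OF h(3)] by (auto simp: bij_betw_def)
  then obtain f where f: "f \<in> Bs" "h z = f z" by blast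
  have fz: "(k \<longlongrightarrow> k z) (nhds z)" if "k \<in> Bs" for k
    using hol[OF that] z
    by (intro isCont_imp_tendsto_nhds complex_diff_at_imp_isCont) (auto simp: holomorphic_several_iff)
  have "\<forall>\<^sub>F y in nhds z. \<forall>k\<in>Bs - {f}. h y \<noteq> k y"
  proof (intro eventually_ball_finite ballI)
    show "finite (Bs - {f})" using fin by simp
    fix k assume k: "k \<in> Bs - {f}"
    have "h z - k z \<noteq> 0"
      using bij[OF z] k f by (auto simp: bij_betw_def inj_on_def)
    moreover have "((\<lambda>y. h y - k y) \<longlongrightarrow> h z - k z) (nhds z)"
      using hz fz k by (intro tendsto_diff) auto
    ultimately have "\<forall>\<^sub>F y in nhds z. h y - k y \<in> - {0}"
      by (intro topological_tendstoD) auto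
    then show "\<forall>\<^sub>F y in nhds z. h y \<noteq> k y" by simp
  qed
  with near h(3) have "\<forall>\<^sub>F y in nhds z. h y = f y"
  proof eventually_elim
    case (elim y)
    then have "h y \<in> (\<lambda>f. f y) ` Bs" using bij[OF elim(1)] by (auto simp: bij_betw_def)
    with elim(3) show ?case by auto
  qed
  then have "g = germ_at z f" by (simp add: h(1) germ_at_eq_iff)
  with f(1) show "g \<in> germ_at z ` Bs" by blast
qed

text \<open>
The condition of \<open>continuation_along\<close> with an arbitrary parameter set in place of the unit interval, so
that a continuation can be restricted to pieces of the path and glued.
\<close>

definition continued_on :: "(real \<Rightarrow> complex ^ 'n::finite) \<Rightarrow> (real \<Rightarrow> 'n germ) \<Rightarrow> real set \<Rightarrow> bool" where
  "continued_on \<gamma> F T \<longleftrightarrow> (\<forall>t\<in>T. \<exists>U f. open U \<and> \<gamma> t \<in> U \<and> holomorphic_several f U \<and>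
        (\<exists>e>0. \<forall>s\<in>T. \<bar>s - t\<bar> < e \<longrightarrow> \<gamma> s \<in> U \<and> F s = germ_at (\<gamma> s) f))"

lemma continuation_along_iff:
  "continuation_along \<gamma> F \<longleftrightarrow> path \<gamma> \<and> continued_on \<gamma> F {0..1}"
  by (simp add: continuation_along_def continued_on_def)

lemma continued_onI:
  assumes "\<And>t. t \<in> T \<Longrightarrow> \<exists>U f e. open U \<and> \<gamma> t \<in> U \<and> holomorphic_several f U \<and> e > 0 \<and>
     (\<forall>s\<in>T. \<bar>s - t\<bar> < e \<longrightarrow> \<gamma> s \<in> U \<and> F s = germ_at (\<gamma> s) f)"
  shows "continued_on \<gamma> F T"
  unfolding continued_on_def
proof
  fix t assume "t \<in> T"
  from assms[OF this] show "\<exists>U f. open U \<and> \<gamma> t \<in> U \<and> holomorphic_several f U \<and>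
        (\<exists>e>0. \<forall>s\<in>T. \<bar>s - t\<bar> < e \<longrightarrow> \<gamma> s \<in> U \<and> F s = germ_at (\<gamma> s) f)"
    by blast
qed

lemma continued_onE:
  assumes "continued_on \<gamma> F T" "t \<in> T"
  obtains U f e where "open U" "\<gamma> t \<in> U" "holomorphic_several f U" "e > 0"
    "\<And>s. \<lbrakk>s \<in> T; \<bar>s - t\<bar> < e\<rbrakk> \<Longrightarrow> \<gamma> s \<in> U \<and> F s = germ_at (\<gamma> s) f"
  using assms unfolding continued_on_def by meson

lemma continued_on_cong:
  assumes "continued_on \<gamma> F T" "\<And>t. t \<in> T \<Longrightarrow> \<gamma>' t = \<gamma> t" "\<And>t. t \<in> T \<Longrightarrow> F' t = F t"
  shows "continued_on \<gamma>' F' T"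
proof (rule continued_onI)
  fix t assume t: "t \<in> T"
  from assms(1) t obtain U f e where "open U" "\<gamma> t \<in> U" "holomorphic_several f U" "e > 0"
    "\<And>s. \<lbrakk>s \<in> T; \<bar>s - t\<bar> < e\<rbrakk> \<Longrightarrow> \<gamma> s \<in> U \<and> F s = germ_at (\<gamma> s) f"
    by (rule continued_onE) blast
  with t show "\<exists>U f e. open U \<and> \<gamma>' t \<in> U \<and> holomorphic_several f U \<and> e > 0 \<and>
     (\<forall>s\<in>T. \<bar>s - t\<bar> < e \<longrightarrow> \<gamma>' s \<in> U \<and> F' s = germ_at (\<gamma>' s) f)"
    by (intro exI[of _ U] exI[of _ f] exI[of _ e]) (auto simp: assms(2,3))
qed

lemma continued_on_reparam:
  assumes F: "continued_on \<gamma> F T" and \<phi>: "continuous_on T' \<phi>" "\<phi> ` T' \<subseteq> T"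
  shows "continued_on (\<gamma> \<circ> \<phi>) (F \<circ> \<phi>) T'"
proof (rule continued_onI)
  fix t assume t: "t \<in> T'"
  then have "\<phi> t \<in> T" using \<phi> by auto
  with F obtain U f e where U: "open U" "\<gamma> (\<phi> t) \<in> U" "holomorphic_several f U" "e > 0"
    "\<And>s. \<lbrakk>s \<in> T; \<bar>s - \<phi> t\<bar> < e\<rbrakk> \<Longrightarrow> \<gamma> s \<in> U \<and> F s = germ_at (\<gamma> s) f"
    by (rule continued_onE) blast
  obtain d where d: "d > 0" "\<And>s. \<lbrakk>s \<in> T'; dist s t < d\<rbrakk> \<Longrightarrow> dist (\<phi> s) (\<phi> t) < e"
    using \<phi>(1) t U(4) unfolding continuous_on_iff by blast
  show "\<exists>U f e. open U \<and> (\<gamma> \<circ> \<phi>) t \<in> U \<and> holomorphic_several f U \<and> e > 0 \<and>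
     (\<forall>s\<in>T'. \<bar>s - t\<bar> < e \<longrightarrow> (\<gamma> \<circ> \<phi>) s \<in> U \<and> (F \<circ> \<phi>) s = germ_at ((\<gamma> \<circ> \<phi>) s) f)"
    using U d \<phi>(2) by (intro exI[of _ U] exI[of _ f] exI[of _ d]) (auto simp: dist_real_def)
qed

text \<open>
Only the junction \<open>b\<close> needs care: the two functions inducing the germs on either side have the same germ
at \<open>\<gamma> b\<close>, hence agree on a neighbourhood, where one of them serves for both sides.
\<close>

lemma continued_on_glue:
  assumes path: "continuous_on {a..c} \<gamma>" and ab: "a \<le> b" and bc: "b \<le> c"
    and F1: "continued_on \<gamma> F {a..b}" and F2: "continued_on \<gamma> F {b..c}"
  shows "continued_on \<gamma> F {a..c}"
proof (rule continued_onI)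
  fix t assume t: "t \<in> {a..c}"
  let ?goal = "\<exists>U f e. open U \<and> \<gamma> t \<in> U \<and> holomorphic_several f U \<and> e > 0 \<and>
     (\<forall>s\<in>{a..c}. \<bar>s - t\<bar> < e \<longrightarrow> \<gamma> s \<in> U \<and> F s = germ_at (\<gamma> s) f)"
  consider "t < b" | "t > b" | "t = b" by linarith
  then show ?goal
  proof cases
    case 1
    with t have "t \<in> {a..b}" by auto
    with F1 obtain U f e where "open U" "\<gamma> t \<in> U" "holomorphic_several f U" "e > 0"
      "\<And>s. \<lbrakk>s \<in> {a..b}; \<bar>s - t\<bar> < e\<rbrakk> \<Longrightarrow> \<gamma> s \<in> U \<and> F s = germ_at (\<gamma> s) f"
      by (rule continued_onE) blast
    with 1 show ?goal by (intro exI[of _ U] exI[of _ f] exI[of _ "min e (b - t)"]) auto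
  next
    case 2
    with t have "t \<in> {b..c}" by auto
    with F2 obtain U f e where "open U" "\<gamma> t \<in> U" "holomorphic_several f U" "e > 0"
      "\<And>s. \<lbrakk>s \<in> {b..c}; \<bar>s - t\<bar> < e\<rbrakk> \<Longrightarrow> \<gamma> s \<in> U \<and> F s = germ_at (\<gamma> s) f"
      by (rule continued_onE) blast
    with 2 show ?goal by (intro exI[of _ U] exI[of _ f] exI[of _ "min e (t - b)"]) auto
  next
    case 3
    have b: "b \<in> {a..b}" "b \<in> {b..c}" using ab bc by auto
    from F1 b(1) obtain U f e where U: "open U" "\<gamma> b \<in> U" "holomorphic_several f U" "e > 0"
      "\<And>s. \<lbrakk>s \<in> {a..b}; \<bar>s - b\<bar> < e\<rbrakk> \<Longrightarrow> \<gamma> s \<in> U \<and> F s = germ_at (\<gamma> s) f"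
      by (rule continued_onE) blast
    from F2 b(2) obtain U' f' e' where U': "open U'" "\<gamma> b \<in> U'" "holomorphic_several f' U'" "e' > 0"
      "\<And>s. \<lbrakk>s \<in> {b..c}; \<bar>s - b\<bar> < e'\<rbrakk> \<Longrightarrow> \<gamma> s \<in> U' \<and> F s = germ_at (\<gamma> s) f'"
      by (rule continued_onE) blast
    have "germ_at (\<gamma> b) f = germ_at (\<gamma> b) f'"
      using U(4) U(5)[of b] U'(4) U'(5)[of b] ab bc by auto
    then have "\<forall>\<^sub>F x in nhds (\<gamma> b). f x = f' x" by (simp add: germ_at_eq_iff)
    then obtain V where V: "open V" "\<gamma> b \<in> V" "\<And>x. x \<in> V \<Longrightarrow> f x = f' x"
      by (auto simp: eventually_nhds)
    define X where "X = V \<inter> U \<inter> U'"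
    have X: "open X" "\<gamma> b \<in> X" using U U' V by (auto simp: X_def)
    have "\<forall>\<^sub>F s in at b within {a..c}. \<gamma> s \<in> X"
      using path X t 3 by (intro topological_tendstoD[of \<gamma> "\<gamma> b"]) (auto simp: continuous_on_def)
    then obtain d where d: "d > 0" "\<And>s. \<lbrakk>s \<in> {a..c}; dist s b < d\<rbrakk> \<Longrightarrow> \<gamma> s \<in> X"
      using X(2) unfolding eventually_at by (metis dist_self)
    have eq: "germ_at x f' = germ_at x f" if "x \<in> X" for x
      unfolding germ_at_eq_iff eventually_nhds
      using that X V(3) by (auto simp: X_def intro!: exI[of _ V] V)
    have "\<gamma> s \<in> X \<and> F s = germ_at (\<gamma> s) f" if "s \<in> {a..c}" "\<bar>s - b\<bar> < Min {d, e, e'}" for s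
    proof -
      have "\<gamma> s \<in> X" using d(2)[of s] that by (simp add: dist_real_def)
      moreover have "F s = germ_at (\<gamma> s) f"
        using that U(5)[of s] U'(5)[of s] eq[OF \<open>\<gamma> s \<in> X\<close>] by (cases "s \<le> b") auto
      ultimately show ?thesis by blast
    qed
    moreover have "holomorphic_several f X"
      using U(3) by (rule holomorphic_several_subset) (auto simp: X_def)
    ultimately show ?goal using X d(1) U(4) U'(4) 3
      by (intro exI[of _ X] exI[of _ f] exI[of _ "Min {d, e, e'}"]) auto
  qed
qed

lemma continues_to_trans:
  assumes "continues_to \<gamma> g h" "continues_to \<delta> h k" "pathfinish \<gamma> = pathstart \<delta>"
  shows "continues_to (\<gamma> +++ \<delta>) g k"
proof -
  from assms obtain F G where F: "path \<gamma>" "continued_on \<gamma> F {0..1}" "F 0 = g" "F 1 = h"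
    and G: "path \<delta>" "continued_on \<delta> G {0..1}" "G 0 = h" "G 1 = k"
    by (auto simp: continues_to_def continuation_along_iff)
  define K where "K t = (if t \<le> 1/2 then F (2 * t) else G (2 * t - 1))" for t
  have half: "t = 1/2" if "t * 2 = 1" for t :: real using that by simp
  have path: "path (\<gamma> +++ \<delta>)" using F(1) G(1) assms(3) by simp
  have "continued_on (\<gamma> +++ \<delta>) K {0..1/2}"
    by (rule continued_on_cong[OF continued_on_reparam[OF F(2), of "{0..1/2}" "\<lambda>t. 2 * t"]])
       (auto simp: K_def joinpaths_def intro!: continuous_intros)
  moreover have "continued_on (\<gamma> +++ \<delta>) K {1/2..1}"
    by (rule continued_on_cong[OF continued_on_reparam[OF G(2), of "{1/2..1}" "\<lambda>t. 2 * t - 1"]])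
       (use assms(3) F(4) G(3) in \<open>auto simp: K_def joinpaths_def pathfinish_def pathstart_def
          intro!: continuous_intros dest!: half\<close>)
  ultimately have "continued_on (\<gamma> +++ \<delta>) K {0..1}"
    using path by (intro continued_on_glue[of 0 1 _ "1/2"]) (auto simp: path_def)
  then show ?thesis unfolding continues_to_def continuation_along_iff
    using path F(3) G(4) by (intro exI[of _ K]) (simp add: K_def)
qed

lemma continues_to_reverse:
  assumes "continues_to \<gamma> g h"
  shows "continues_to (reversepath \<gamma>) h g"
proof -
  from assms obtain F where F: "path \<gamma>" "continued_on \<gamma> F {0..1}" "F 0 = g" "F 1 = h"
    by (auto simp: continues_to_def continuation_along_iff)
  have "continued_on (reversepath \<gamma>) (F \<circ> (\<lambda>t. 1 - t)) {0..1}"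
    by (rule continued_on_cong[OF continued_on_reparam[OF F(2), of "{0..1}" "\<lambda>t. 1 - t"]])
       (auto simp: reversepath_def intro!: continuous_intros)
  with F show ?thesis unfolding continues_to_def continuation_along_iff
    by (intro exI[of _ "F \<circ> (\<lambda>t. 1 - t)"]) simp
qed

lemma continues_to_within:
  assumes hol: "holomorphic_several f U" "open U" and \<gamma>: "path \<gamma>" "path_image \<gamma> \<subseteq> U"
  shows "continues_to \<gamma> (germ_at (pathstart \<gamma>) f) (germ_at (pathfinish \<gamma>) f)"
proof -
  have "continued_on \<gamma> (\<lambda>t. germ_at (\<gamma> t) f) {0..1}"
    using assms by (intro continued_onI exI[of _ U] exI[of _ f] exI[of _ 1]) (auto simp: path_image_def)
  then show ?thesis using \<gamma>(1)
    by (auto simp: continues_to_def continuation_along_iff pathstart_def pathfinish_def)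
qed

lemma continues_to_fst:
  assumes "continues_to \<gamma> g h"
  shows "fst g = pathstart \<gamma>" "fst h = pathfinish \<gamma>"
proof -
  from assms obtain F where F: "continued_on \<gamma> F {0..1}" "F 0 = g" "F 1 = h"
    by (auto simp: continues_to_def continuation_along_iff)
  have "fst (F t) = \<gamma> t" if "t \<in> {0..1}" for t
    using F(1) that by (rule continued_onE) (use that in auto)
  with F show "fst g = pathstart \<gamma>" "fst h = pathfinish \<gamma>"
    by (auto simp: pathstart_def pathfinish_def)
qed

text \<open>
By the identity theorem on a small ball around \<open>\<gamma> x\<close>, two continuations agree at one parameter near \<open>x\<close>
iff they agree at all of them. So whether they agree is locally constant along the path.
\<close>

lemma continues_to_unique:
  assumes "continues_to \<gamma> g h" "continues_to \<gamma> g h'"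
  shows "h = h'"
proof -
  from assms obtain F F' where F: "path \<gamma>" "continued_on \<gamma> F {0..1}" "F 0 = g" "F 1 = h"
    and F': "continued_on \<gamma> F' {0..1}" "F' 0 = g" "F' 1 = h'"
    by (auto simp: continues_to_def continuation_along_iff)
  have cont: "continuous_on {0..1} \<gamma>" using F(1) by (simp add: path_def)
  have "0 \<le> a \<longrightarrow> b \<le> 1 \<longrightarrow> (F a = F' a \<longleftrightarrow> F b = F' b)" if "a = 0" "b = 1" for a b :: real
  proof (rule Bolzano[of a b])
    show "a \<le> b" using that by simp
    show "0 \<le> a \<longrightarrow> c \<le> 1 \<longrightarrow> (F a = F' a \<longleftrightarrow> F c = F' c)"
      if "0 \<le> a \<longrightarrow> b \<le> 1 \<longrightarrow> (F a = F' a \<longleftrightarrow> F b = F' b)"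
        "0 \<le> b \<longrightarrow> c \<le> 1 \<longrightarrow> (F b = F' b \<longleftrightarrow> F c = F' c)" "a \<le> b" "b \<le> c" for a b c
      using that by auto
    fix x assume "a \<le> x" "x \<le> b"
    then have x: "x \<in> {0..1}" using that by auto
    from F(2) x obtain U f e where U: "open U" "\<gamma> x \<in> U" "holomorphic_several f U" "e > 0"
      "\<And>s. \<lbrakk>s \<in> {0..1}; \<bar>s - x\<bar> < e\<rbrakk> \<Longrightarrow> \<gamma> s \<in> U \<and> F s = germ_at (\<gamma> s) f"
      by (rule continued_onE) blast
    from F'(1) x obtain U' f' e' where U': "open U'" "\<gamma> x \<in> U'" "holomorphic_several f' U'" "e' > 0"
      "\<And>s. \<lbrakk>s \<in> {0..1}; \<bar>s - x\<bar> < e'\<rbrakk> \<Longrightarrow> \<gamma> s \<in> U' \<and> F' s = germ_at (\<gamma> s) f'"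
      by (rule continued_onE) blast
    obtain r where r: "r > 0" "ball (\<gamma> x) r \<subseteq> U \<inter> U'"
      using openE[OF open_Int[OF U(1) U'(1)], of "\<gamma> x"] U(2) U'(2) by blast
    let ?B = "ball (\<gamma> x) r"
    obtain d where d: "d > 0" "\<And>s. \<lbrakk>s \<in> {0..1}; dist s x < d\<rbrakk> \<Longrightarrow> dist (\<gamma> s) (\<gamma> x) < r"
      using cont x r(1) unfolding continuous_on_iff by blast
    have hol: "holomorphic_several f ?B" "holomorphic_several f' ?B"
      using holomorphic_several_subset[OF U(3)] holomorphic_several_subset[OF U'(3)] r(2) by auto
    have agree: "F s = F' s \<longleftrightarrow> (\<forall>z\<in>?B. f z = f' z)"
      if s: "s \<in> {0..1}" "\<bar>s - x\<bar> < Min {d, e, e'}" for s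
    proof -
      have sB: "\<gamma> s \<in> ?B" using d(2)[of s] s by (simp add: dist_real_def dist_commute)
      have "F s = F' s \<longleftrightarrow> (\<forall>\<^sub>F z in nhds (\<gamma> s). f z = f' z)"
        using U(5)[of s] U'(5)[of s] s by (simp add: germ_at_eq_iff)
      also have "\<dots> \<longleftrightarrow> (\<forall>z\<in>?B. f z = f' z)"
      proof
        assume "\<forall>\<^sub>F z in nhds (\<gamma> s). f z = f' z"
        then show "\<forall>z\<in>?B. f z = f' z"
          using identity_on_convex[OF open_ball convex_ball hol sB] by blast
      next
        assume "\<forall>z\<in>?B. f z = f' z"
        then show "\<forall>\<^sub>F z in nhds (\<gamma> s). f z = f' z"
          unfolding eventually_nhds using sB open_ball by blast
      qed
      finally show ?thesis .
    qed
    show "\<exists>d>0. \<forall>a b. a \<le> x \<and> x \<le> b \<and> b - a < d \<longrightarrow>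
        0 \<le> a \<longrightarrow> b \<le> 1 \<longrightarrow> (F a = F' a \<longleftrightarrow> F b = F' b)"
      using d(1) U(4) U'(4) agree by (intro exI[of _ "Min {d, e, e'}"]) auto
  qed
  with F F' show ?thesis by auto
qed

text \<open>
On a piece of the path within a ball carrying all local branches, a solution germ is one of these branches and
is continued by it. Finitely many such pieces cover the path.
\<close>

lemma solution_germ_continues:
  fixes P :: "'n::{finite,linorder} mpoly poly"
  assumes \<gamma>: "path \<gamma>" "path_image \<gamma> \<inter> branch_locus P = {}"
    and g: "g \<in> solution_germs P (pathstart \<gamma>)"
  obtains h where "continues_to \<gamma> g h" "h \<in> solution_germs P (pathfinish \<gamma>)"
proof -
  have cont: "continuous_on {0..1} \<gamma>" using \<gamma>(1) by (simp add: path_def)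
  define Q where "Q a b \<longleftrightarrow> (0 \<le> a \<longrightarrow> a \<le> b \<longrightarrow> b \<le> 1 \<longrightarrow> (\<forall>g\<in>solution_germs P (\<gamma> a).
      \<exists>F. F a = g \<and> F b \<in> solution_germs P (\<gamma> b) \<and> continued_on \<gamma> F {a..b}))" for a b :: real
  have "Q 0 1"
  proof (rule Bolzano)
    fix a b c :: real assume ab: "Q a b" and bc: "Q b c" and le: "a \<le> b" "b \<le> c"
    show "Q a c" unfolding Q_def
    proof (intro impI ballI)
      fix g assume a: "0 \<le> a" and c: "c \<le> 1" and g: "g \<in> solution_germs P (\<gamma> a)"
      from ab a c le g obtain F where F: "F a = g" "F b \<in> solution_germs P (\<gamma> b)" "continued_on \<gamma> F {a..b}"
        by (auto simp: Q_def)
      from bc a c le F(2) obtain G where G: "G b = F b" "G c \<in> solution_germs P (\<gamma> c)" "continued_on \<gamma> G {b..c}"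
        by (auto simp: Q_def)
      define K where "K t = (if t \<le> b then F t else G t)" for t
      have "continued_on \<gamma> K {a..b}"
        by (rule continued_on_cong[OF F(3)]) (auto simp: K_def)
      moreover have "continued_on \<gamma> K {b..c}"
        by (rule continued_on_cong[OF G(3)]) (auto simp: K_def G(1))
      moreover have "continuous_on {a..c} \<gamma>"
        using cont by (rule continuous_on_subset) (use a c in auto)
      ultimately have "continued_on \<gamma> K {a..c}" 
        using le by (intro continued_on_glue[of a c \<gamma> b])
      then show "\<exists>F. F a = g \<and> F c \<in> solution_germs P (\<gamma> c) \<and> continued_on \<gamma> F {a..c}"
        using F(1,2) G(1,2) le by (intro exI[of _ K]) (auto simp: K_def)
    qed
  next
    fix x :: real assume "0 \<le> x" "x \<le> 1"
    then have x: "x \<in> {0..1}" by simp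
    with \<gamma>(2) have "\<gamma> x \<notin> branch_locus P" unfolding path_image_def by blast
    then obtain r Bs where r: "r > 0" and fin: "finite Bs"
      and hol: "\<And>f. f \<in> Bs \<Longrightarrow> holomorphic_several f (ball (\<gamma> x) r)"
      and bij: "\<And>z. z \<in> ball (\<gamma> x) r \<Longrightarrow> bij_betw (\<lambda>f. f z) Bs {w. poly (equation_at P z) w = 0}"
      by (rule local_branches) blast

    obtain d where d: "d > 0" "\<And>s. \<lbrakk>s \<in> {0..1}; dist s x < d\<rbrakk> \<Longrightarrow> dist (\<gamma> s) (\<gamma> x) < r"
      using cont x r unfolding continuous_on_iff by blast
    have "Q a b" if ab: "a \<le> x" "x \<le> b" "b - a < d" for a b
      unfolding Q_def
    proof (intro impI ballI)
      fix g assume a: "0 \<le> a" and b: "b \<le> 1" and g: "g \<in> solution_germs P (\<gamma> a)"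
      have inB: "\<gamma> s \<in> ball (\<gamma> x) r" if "s \<in> {a..b}" for s
      proof -
        have "\<bar>s - x\<bar> < d" using that ab by (auto simp: abs_less_iff)
        with d(2)[of s] that a b show ?thesis by (simp add: dist_real_def dist_commute)
      qed
      have "g \<in> germ_at (\<gamma> a) ` Bs"
        using g solution_germs_local[OF hol fin bij inB[of a]] ab by auto
      then obtain f where f: "f \<in> Bs" "g = germ_at (\<gamma> a) f" by blast
      have "continued_on \<gamma> (\<lambda>t. germ_at (\<gamma> t) f) {a..b}"
        using inB hol[OF f(1)]
        by (intro continued_onI exI[of _ "ball (\<gamma> x) r"] exI[of _ f] exI[of _ 1]) auto
      moreover have "germ_at (\<gamma> b) f \<in> solution_germs P (\<gamma> b)"
        using f(1) solution_germs_local[OF hol fin bij inB[of b]] ab by auto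
      ultimately show "\<exists>F. F a = g \<and> F b \<in> solution_germs P (\<gamma> b) \<and> continued_on \<gamma> F {a..b}"
        using f(2) by (intro exI[of _ "\<lambda>t. germ_at (\<gamma> t) f"]) auto
    qed
    then show "\<exists>d>0. \<forall>a b. a \<le> x \<and> x \<le> b \<and> b - a < d \<longrightarrow> Q a b" using d(1) by blast
  qed simp
  then obtain F where "F 0 = g" "F 1 \<in> solution_germs P (\<gamma> 1)" "continued_on \<gamma> F {0..1}"
    using g by (auto simp: Q_def pathstart_def)
  then show ?thesis
    using \<gamma>(1) by (intro that[of "F 1"]) (auto simp: continues_to_def continuation_along_iff pathfinish_def)
qed

lemma generated_by_eq:
  assumes "continues_to \<gamma> g h"
  shows "generated_by g = generated_by h"
proof -
  have "generated_by h \<subseteq> generated_by g" if gh: "continues_to \<gamma> g h" for \<gamma> g h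
  proof
    fix k assume "k \<in> generated_by h"
    then obtain \<delta> where hk: "continues_to \<delta> h k" by (auto simp: generated_by_def)
    have "pathfinish \<gamma> = pathstart \<delta>"
      using continues_to_fst(2)[OF gh] continues_to_fst(1)[OF hk] by simp
    from continues_to_trans[OF gh hk this] show "k \<in> generated_by g"
      by (auto simp: generated_by_def)
  qed
  from this[OF assms] this[OF continues_to_reverse[OF assms]] show ?thesis by blast
qed

section \<open>Single-valued functions of polynomial growth\<close>

lemma poly_growth:
  fixes p :: "complex poly"
  assumes "degree p \<le> d"
  shows "\<exists>B\<ge>0. \<forall>t. cmod (poly p t) \<le> B * (1 + cmod t) ^ d"
proof (intro exI conjI allI)
  show "0 \<le> (\<Sum>i\<le>degree p. cmod (coeff p i))" by (rule sum_nonneg) simp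
  fix t
  have "cmod (poly p t) \<le> (\<Sum>i\<le>degree p. cmod (coeff p i * t ^ i))"
    unfolding poly_altdef by (rule norm_sum)
  also have "\<dots> \<le> (\<Sum>i\<le>degree p. cmod (coeff p i) * (1 + cmod t) ^ d)"
  proof (rule sum_mono)
    fix i assume "i \<in> {..degree p}"
    then have "i \<le> d" using assms by simp
    have "cmod t ^ i \<le> (1 + cmod t) ^ i" by (rule power_mono) auto
    also have "\<dots> \<le> (1 + cmod t) ^ d" using \<open>i \<le> d\<close> by (rule power_increasing) simp
    finally show "cmod (coeff p i * t ^ i) \<le> cmod (coeff p i) * (1 + cmod t) ^ d"
      by (simp add: norm_mult norm_power mult_left_mono)
  qed
  finally show "cmod (poly p t) \<le> (\<Sum>i\<le>degree p. cmod (coeff p i)) * (1 + cmod t) ^ d"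
    by (simp add: sum_distrib_right)
qed

lemma holomorphic_outside_finite_imp_poly:
  assumes S: "finite S" and hol: "f holomorphic_on (- S)" and B: "B \<ge> 0"
    and bound: "\<And>t. t \<notin> S \<Longrightarrow> cmod (f t) \<le> B * (1 + cmod t) ^ d"
  shows "\<exists>p. degree p \<le> d \<and> (\<forall>t. t \<notin> S \<longrightarrow> f t = poly p t)"
proof -
  have "f \<in> O[at z](\<lambda>_. 1)" if "z \<in> S" for z
  proof (rule bigoI)
    have "\<forall>\<^sub>F t in at z. dist t z < 1"
      by (rule eventually_at_ball'[THEN eventually_mono]) (auto simp: dist_commute intro: zero_less_one)
    moreover have "\<forall>\<^sub>F t in at z. t \<notin> S"
    proof -
      have "\<not> z islimpt S" using S by (rule islimpt_finite)
      then show ?thesis by (simp add: islimpt_iff_eventually)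
    qed
    ultimately show "\<forall>\<^sub>F t in at z. norm (f t) \<le> (B * (2 + cmod z) ^ d) * norm (1::complex)"
    proof eventually_elim
      case (elim t)
      have "cmod t \<le> cmod z + 1"
        using elim(1) norm_triangle_ineq3[of t z] by (simp add: dist_norm)
      then have "B * (1 + cmod t) ^ d \<le> B * (2 + cmod z) ^ d"
        by (intro mult_left_mono power_mono B) auto
      with bound[OF elim(2)] show ?case by simp
    qed
  qed
  then obtain g where g: "g holomorphic_on UNIV" "\<And>t. t \<notin> S \<Longrightarrow> g t = f t"
    using removable_singularities[of S UNIV f] S hol by (auto simp: Compl_eq_Diff_UNIV)
  \<comment> \<open>Outside radius \<open>A\<close> there are no exceptional points, and \<open>1 + \<bar>t\<bar> \<le> 2 \<bar>t\<bar>\<close>.\<close>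
  define A where "A = 1 + (\<Sum>s\<in>S. cmod s)"
  have A: "cmod (g t) \<le> (B * 2 ^ d) * cmod t ^ d" if "A \<le> cmod t" for t
  proof -
    have "t \<notin> S"
    proof
      assume "t \<in> S"
      then have "cmod t \<le> (\<Sum>s\<in>S. cmod s)" using S by (intro member_le_sum) auto
      with that show False by (simp add: A_def)
    qed
    have "A \<ge> 1" by (simp add: A_def sum_nonneg)
    have "cmod (g t) \<le> B * (1 + cmod t) ^ d" using bound[OF \<open>t \<notin> S\<close>] g(2)[OF \<open>t \<notin> S\<close>] by simp
    also have "\<dots> \<le> B * (2 * cmod t) ^ d"
      using that \<open>A \<ge> 1\<close> by (intro mult_left_mono power_mono B) auto
    finally show ?thesis by (simp add: power_mult_distrib mult_ac)
  qed
  define p where "p = (\<Sum>k\<le>d. Polynomial.monom ((deriv ^^ k) g 0 / fact k) k)"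
  have "degree p \<le> d"
    unfolding p_def by (intro degree_sum_le) (auto intro: order.trans[OF degree_monom_le])
  moreover have "poly p t = g t" for t
    using Liouville_polynomial[OF g(1) A, where \<xi> = t] by (simp add: p_def poly_sum poly_monom)
  ultimately show ?thesis using g(2) by metis
qed

lemma Lagrange_basis:
  fixes N :: "'a::field set"
  assumes N: "finite N"
  obtains L where "\<And>p s. degree p < card N \<Longrightarrow> poly p s = (\<Sum>t\<in>N. poly p t * poly (L t) s)"
proof -
  define L where "L t = (\<Prod>u\<in>N - {t}. Polynomial.smult (inverse (t - u)) [:- u, 1:])" for t
  have Lval: "poly (L t) s = (if s = t then 1 else 0)" if "s \<in> N" "t \<in> N" for s t
  proof (cases "s = t")
    case True
    have "poly (Polynomial.smult (inverse (t - u)) [:- u, 1:]) t = 1" if "u \<in> N - {t}" for u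
    proof -
      have "poly (Polynomial.smult (inverse (t - u)) [:- u, 1:]) t = inverse (t - u) * (t - u)"
        by (simp add: algebra_simps)
      also have "\<dots> = 1" using that by (intro left_inverse) auto
      finally show ?thesis .
    qed
    with True show ?thesis unfolding L_def poly_prod by (simp only: prod.neutral_const cong: prod.cong) simp
  next
    case False
    then show ?thesis using that N by (auto simp: L_def poly_prod prod_zero_iff intro!: bexI[of _ s])
  qed
  have Ldeg: "degree (L t) < card N" if t: "t \<in> N" for t
  proof -
    have "degree (L t) \<le> (\<Sum>u\<in>N - {t}. degree (Polynomial.smult (inverse (t - u)) [:- u, 1:]))"
      unfolding L_def by (rule order.trans[OF degree_prod_sum_le]) (use N in auto)
    also have "\<dots> \<le> (\<Sum>u\<in>N - {t}. 1)"
      by (intro sum_mono order.trans[OF degree_smult_le]) simp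
    also have "\<dots> < card N" using card_Diff1_less[OF N t] by simp
    finally show ?thesis .
  qed
  have "poly p s = (\<Sum>t\<in>N. poly p t * poly (L t) s)" if p: "degree p < card N" for p s
  proof -
    define q where "q = (\<Sum>t\<in>N. Polynomial.smult (poly p t) (L t))"
    have "N \<noteq> {}" using p by auto
    then have "degree q < card N"
      unfolding q_def using p Ldeg
      by (intro degree_sum_less) (auto intro: le_less_trans[OF degree_smult_le])
    moreover have "poly p t = poly q t" if "t \<in> N" for t
      using that N by (simp add: q_def poly_sum Lval mult_delta_right)
    ultimately have "p = q" using p by (intro poly_eqI_degree[of N]) auto
    then have "poly p s = poly q s" by simp
    then show ?thesis by (simp add: q_def poly_sum)
  qed
  then show ?thesis by (rule that)
qed

definition replace_coord :: "'n::finite \<Rightarrow> complex \<Rightarrow> complex ^ 'n \<Rightarrow> complex ^ 'n" where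
  "replace_coord i t b = (\<chi> j. if j = i then t else vec_nth b j)"

lemma replace_coord_nth [simp]:
  "vec_nth (replace_coord i t b) j = (if j = i then t else vec_nth b j)"
  by (simp add: replace_coord_def)

definition polydisc :: "complex ^ 'n::finite \<Rightarrow> real \<Rightarrow> (complex ^ 'n) set" where
  "polydisc c r = {b. \<forall>i. dist (vec_nth c i) (vec_nth b i) < r}"

lemma polydisc_subset_ball:
  fixes c :: "complex ^ 'n::finite"
  assumes "e > 0"
  obtains r where "r > 0" "polydisc c r \<subseteq> ball c e"
proof
  define r where "r = e / real CARD('n)"
  show "r > 0" using assms by (simp add: r_def)
  show "polydisc c r \<subseteq> ball c e"
  proof
    fix b assume b: "b \<in> polydisc c r"
    have "norm (c - b) \<le> (\<Sum>i\<in>UNIV. norm (vec_nth (c - b) i))"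
      unfolding norm_vec_def by (rule L2_set_le_sum) simp
    also have "\<dots> < (\<Sum>i\<in>(UNIV::'n set). r)"
      using b by (intro sum_strict_mono) (auto simp: polydisc_def dist_norm)
    also have "\<dots> = e" by (simp add: r_def)
    finally show "b \<in> ball c e" by (simp add: dist_norm)
  qed
qed

lemma open_polydisc: "open (polydisc c r)"
proof -
  have "polydisc c r = (\<Inter>i\<in>UNIV. {b. dist (vec_nth c i) (vec_nth b i) < r})"
    by (auto simp: polydisc_def)
  then show ?thesis
    by (auto intro!: open_INT open_Collect_less continuous_intros)
qed

lemma polynomial_map_poly [intro]:
  "polynomial_map f \<Longrightarrow> polynomial_map (\<lambda>x. poly q (f x))"
  unfolding poly_altdef
  by (intro polynomial_map_sum polynomial_map_mult polynomial_map_const polynomial_map_power)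

text \<open>
Interpolating in one variable with \<open>d + 1\<close> fixed nodes writes \<open>G\<close> as a combination of functions that no
longer depend on this variable, with polynomial coefficients. The induction is on a set of variables that
\<open>G\<close> depends on.
\<close>

lemma separately_polynomial_imp_polynomial:
  fixes G :: "complex ^ 'n::finite \<Rightarrow> complex"
  assumes r: "r > 0"
    and sep: "\<And>b i. b \<in> polydisc c r \<Longrightarrow> \<exists>p. degree p \<le> d \<and>
      (\<forall>t. dist (vec_nth c i) t < r \<longrightarrow> G (replace_coord i t b) = poly p t)"
  shows "\<exists>H. polynomial_map H \<and> (\<forall>b\<in>polydisc c r. G b = H b)"
proof -
  let ?sep = "\<lambda>G. \<forall>b i. b \<in> polydisc c r \<longrightarrow> (\<exists>p. degree p \<le> d \<and>
      (\<forall>t. dist (vec_nth c i) t < r \<longrightarrow> G (replace_coord i t b) = poly p t))"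
  have "\<exists>H. polynomial_map H \<and> (\<forall>b\<in>polydisc c r. G b = H b)"
    if "finite I" "?sep G"
      "\<forall>b\<in>polydisc c r. \<forall>b'\<in>polydisc c r. (\<forall>i\<in>I. vec_nth b i = vec_nth b' i) \<longrightarrow> G b = G b'"
    for I and G :: "complex ^ 'n \<Rightarrow> complex"
    using that
  proof (induction I arbitrary: G rule: finite_induct)
    case empty
    have "c \<in> polydisc c r" using r by (simp add: polydisc_def)
    then have "\<forall>b\<in>polydisc c r. G b = G c" using empty(2) by blast
    then show ?case by (intro exI[of _ "\<lambda>_. G c"] conjI polynomial_map_const)
  next
    case (insert i I)
    have "infinite (ball (vec_nth c i) r)" using uncountable_ball[OF r] countable_finite by blast
    then obtain N where N: "finite N" "card N = Suc d" "N \<subseteq> ball (vec_nth c i) r"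
      using infinite_arbitrarily_large by metis
    obtain L where L: "\<And>p s. degree p < card N \<Longrightarrow> poly p s = (\<Sum>t\<in>N. poly p t * poly (L t) s)"
      using Lagrange_basis[OF N(1)] by metis
    have rep: "replace_coord i t b \<in> polydisc c r" if "t \<in> N" "b \<in> polydisc c r" for t b
      using that N(3) by (auto simp: polydisc_def)
    have "\<exists>H. polynomial_map H \<and> (\<forall>b\<in>polydisc c r. G (replace_coord i t b) = H b)" if t: "t \<in> N" for t
    proof (rule insert.IH)
      show "?sep (\<lambda>b. G (replace_coord i t b))"
      proof (intro allI impI)
        fix b j assume b: "b \<in> polydisc c r"
        show "\<exists>p. degree p \<le> d \<and> (\<forall>s. dist (vec_nth c j) s < r \<longrightarrow>
            G (replace_coord i t (replace_coord j s b)) = poly p s)"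
        proof (cases "j = i")
          case True
          have "replace_coord i t (replace_coord j s b) = replace_coord i t b" for s
            using True by (simp add: Finite_Cartesian_Product.vec_eq_iff)
          then show ?thesis by (intro exI[of _ "[:G (replace_coord i t b):]"]) simp
        next
          case False
          have "replace_coord i t (replace_coord j s b) = replace_coord j s (replace_coord i t b)" for s
            using False by (simp add: Finite_Cartesian_Product.vec_eq_iff)
          then show ?thesis using insert.prems(1) rep[OF t b] by simp
        qed
      qed
      show "\<forall>b\<in>polydisc c r. \<forall>b'\<in>polydisc c r. (\<forall>i\<in>I. vec_nth b i = vec_nth b' i) \<longrightarrow>
          G (replace_coord i t b) = G (replace_coord i t b')"
        using insert.prems(2) rep[OF t] by auto
    qed
    then obtain H where H: "\<And>t. t \<in> N \<Longrightarrow> polynomial_map (H t)"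
      "\<And>t b. \<lbrakk>t \<in> N; b \<in> polydisc c r\<rbrakk> \<Longrightarrow> G (replace_coord i t b) = H t b"
      by metis
    have "G b = (\<Sum>t\<in>N. H t b * poly (L t) (vec_nth b i))" if b: "b \<in> polydisc c r" for b
    proof -
      obtain p where p: "degree p \<le> d"
        "\<And>t. dist (vec_nth c i) t < r \<Longrightarrow> G (replace_coord i t b) = poly p t"
        using insert.prems(1) b by blast
      have "replace_coord i (vec_nth b i) b = b" by (simp add: Finite_Cartesian_Product.vec_eq_iff)
      then have "G b = poly p (vec_nth b i)"
        using p(2)[of "vec_nth b i"] b by (simp add: polydisc_def)
      also have "\<dots> = (\<Sum>t\<in>N. poly p t * poly (L t) (vec_nth b i))"
        using p(1) N(2) by (intro L) simp
      also have "\<dots> = (\<Sum>t\<in>N. H t b * poly (L t) (vec_nth b i))"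
        using p(2) N(3) H(2)[OF _ b] by (intro sum.cong) (auto simp: subset_iff)
      finally show ?thesis .
    qed
    moreover have "polynomial_map (\<lambda>b. \<Sum>t\<in>N. H t b * poly (L t) (vec_nth b i))"
      using H(1) by (intro polynomial_map_sum polynomial_map_mult polynomial_map_poly polynomial_map_component) auto
    ultimately show ?case by blast
  qed
  from this[of UNIV G] sep show ?thesis
    by (simp add: Finite_Cartesian_Product.vec_eq_iff[symmetric])
qed

text \<open>
The bound plays two roles on each coordinate line: locally it makes the finitely many zeros of \<open>D\<close> on the
line removable, and at infinity it limits the degree, by \<open>d k\<close> if all \<open>c\<^sub>i\<close> restrict to polynomials of
degree at most \<open>d\<close>.
\<close>

lemma polynomial_growth_imp_polynomial:
  fixes G :: "complex ^ 'n::finite \<Rightarrow> complex" and c :: "'i \<Rightarrow> 'n mpoly"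
  assumes hol: "holomorphic_several G {x. mpoly_eval D x \<noteq> 0}" and x0: "mpoly_eval D x0 \<noteq> 0"
    and S: "finite S" and C: "C \<ge> 0"
    and bound: "\<And>x. mpoly_eval D x \<noteq> 0 \<Longrightarrow> cmod (G x) \<le> C * (\<Sum>i\<in>S. cmod (mpoly_eval (c i) x)) ^ k"
  shows "\<exists>p. \<forall>\<^sub>F x in nhds x0. G x = mpoly_eval p x"
proof -
  have "\<forall>j. \<exists>d. \<forall>a v. degree (restrict_to_line a v (c j)) \<le> d"
    using degree_restrict_to_line_bounded by blast
  then obtain dg where dg: "\<And>j a v. degree (restrict_to_line a v (c j)) \<le> dg j" by metis
  define d where "d = (\<Sum>j\<in>S. dg j)"
  have d: "degree (restrict_to_line a v (c j)) \<le> d" if "j \<in> S" for a v j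
    using dg[of a v j] member_le_sum[of j S dg] that S by (simp add: d_def)
  have "\<forall>\<^sub>F x in nhds x0. mpoly_eval D x \<in> - {0}"
    by (rule topological_tendstoD[OF isCont_mpoly_eval[of x0 D, THEN isCont_imp_tendsto_nhds]])
       (use x0 in auto)
  then obtain e where e: "e > 0" "\<And>x. dist x x0 < e \<Longrightarrow> mpoly_eval D x \<noteq> 0"
    unfolding eventually_nhds_metric by auto
  obtain r where r: "r > 0" "polydisc x0 r \<subseteq> ball x0 e"
    using polydisc_subset_ball[OF e(1)] by blast
  have D: "mpoly_eval D b \<noteq> 0" if "b \<in> polydisc x0 r" for b
    using that r(2) e(2)[of b] by (auto simp: dist_commute)
  have "\<exists>H. polynomial_map H \<and> (\<forall>b\<in>polydisc x0 r. G b = H b)"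
  proof (rule separately_polynomial_imp_polynomial[OF r(1)])
    fix b i assume b: "b \<in> polydisc x0 r"
    define a where "a = replace_coord i 0 b"
    define v :: "complex ^ 'n" where "v = axis i 1"
    have line: "replace_coord i t b = a + t *s v" for t
      by (simp add: Finite_Cartesian_Product.vec_eq_iff a_def v_def axis_def)
    define T where "T = {t. mpoly_eval D (a + t *s v) = 0}"
    have "poly (restrict_to_line a v D) (vec_nth b i) \<noteq> 0"
    proof -
      have "a + vec_nth b i *s v = b"
        by (simp add: line[symmetric] Finite_Cartesian_Product.vec_eq_iff)
      then show ?thesis using D[OF b] by (simp add: poly_restrict_to_line)
    qed
    then have "restrict_to_line a v D \<noteq> 0" by (metis poly_0)
    then have T: "finite T"
      using poly_roots_finite[of "restrict_to_line a v D"] by (simp add: T_def poly_restrict_to_line)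
    have holT: "(\<lambda>t. G (a + t *s v)) holomorphic_on (- T)"
      unfolding holomorphic_on_def
    proof
      fix t assume "t \<in> - T"
      then have "complex_diff_at G (a + t *s v)"
        using hol by (simp add: holomorphic_several_iff T_def)
      then show "(\<lambda>t. G (a + t *s v)) field_differentiable at t within - T"
        by (rule field_differentiable_at_within[OF complex_diff_at_on_line])
    qed
    have "\<forall>j\<in>S. \<exists>B\<ge>0. \<forall>t. cmod (poly (restrict_to_line a v (c j)) t) \<le> B * (1 + cmod t) ^ d"
      using poly_growth[OF d] by blast
    then obtain B where B: "\<And>j. j \<in> S \<Longrightarrow> B j \<ge> 0"
      "\<And>j t. j \<in> S \<Longrightarrow> cmod (poly (restrict_to_line a v (c j)) t) \<le> B j * (1 + cmod t) ^ d"
      by metis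
    define B' where "B' = C * (\<Sum>j\<in>S. B j) ^ k"
    have "B' \<ge> 0" using C B(1) by (simp add: B'_def sum_nonneg)
    moreover have "cmod (G (a + t *s v)) \<le> B' * (1 + cmod t) ^ (d * k)" if "t \<notin> T" for t
    proof -
      have "cmod (G (a + t *s v)) \<le> C * (\<Sum>j\<in>S. cmod (mpoly_eval (c j) (a + t *s v))) ^ k"
        using that by (intro bound) (simp add: T_def)
      also have "\<dots> \<le> C * (\<Sum>j\<in>S. B j * (1 + cmod t) ^ d) ^ k"
        using B(2) by (intro mult_left_mono[OF _ C] power_mono sum_mono sum_nonneg)
          (auto simp: poly_restrict_to_line)
      also have "\<dots> = B' * (1 + cmod t) ^ (d * k)"
        by (simp add: B'_def power_mult power_mult_distrib flip: sum_distrib_right)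
      finally show ?thesis .
    qed
    ultimately have "\<exists>p. degree p \<le> d * k \<and> (\<forall>t. t \<notin> T \<longrightarrow> G (a + t *s v) = poly p t)"
      by (rule holomorphic_outside_finite_imp_poly[OF T holT])
    then obtain p where p: "degree p \<le> d * k" "\<And>t. t \<notin> T \<Longrightarrow> G (a + t *s v) = poly p t"
      by blast
    show "\<exists>p. degree p \<le> d * k \<and>
        (\<forall>t. dist (vec_nth x0 i) t < r \<longrightarrow> G (replace_coord i t b) = poly p t)"
    proof (intro exI conjI allI impI)
      show "degree p \<le> d * k" by (rule p(1))
      fix t assume t: "dist (vec_nth x0 i) t < r"
      then have "replace_coord i t b \<in> polydisc x0 r" using b by (auto simp: polydisc_def)
      then have "t \<notin> T" using D by (auto simp: T_def line)
      then show "G (replace_coord i t b) = poly p t" using p(2) by (simp add: line)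
    qed
  qed
  then obtain p where p: "\<And>b. b \<in> polydisc x0 r \<Longrightarrow> G b = mpoly_eval p b"
    by (auto simp: polynomial_map_def)
  have "x0 \<in> polydisc x0 r" using r(1) by (simp add: polydisc_def)
  with p open_polydisc[of x0 r] have "\<forall>\<^sub>F x in nhds x0. G x = mpoly_eval p x"
    unfolding eventually_nhds by blast
  then show ?thesis by blast
qed

section \<open>Transport of branches\<close>

text \<open>
The complex line through \<open>a\<close> and \<open>b\<close> meets the branch locus in a finite set, and a real plane minus a
finite set is path connected.
\<close>

lemma branch_locus_complement_connected:
  fixes P :: "'n::{finite,linorder} mpoly poly"
  assumes a: "a \<notin> branch_locus P" and b: "b \<notin> branch_locus P"
  obtains \<gamma> where "path \<gamma>" "pathstart \<gamma> = a" "pathfinish \<gamma> = b" "path_image \<gamma> \<inter> branch_locus P = {}"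
proof -
  define v where "v = b - a"
  have line: "a + 0 *s v = a" "a + 1 *s v = b" by (simp_all add: v_def)
  define T where "T = {t. a + t *s v \<in> branch_locus P}"
  have "finite T" unfolding T_def
    by (rule finite_branch_locus_on_line[of a 0]) (use a line in simp)
  then have "path_connected (- T)"
    by (intro path_connected_complement_countable) (auto intro: countable_finite)
  moreover have "0 \<in> - T" "1 \<in> - T" using a b line by (auto simp: T_def)
  ultimately obtain \<delta> where \<delta>: "path \<delta>" "path_image \<delta> \<subseteq> - T" "pathstart \<delta> = 0" "pathfinish \<delta> = 1"
    unfolding path_connected_def by blast
  have cont: "continuous_on UNIV (\<lambda>t :: complex. a + t *s v)"
    by (intro continuous_intros continuous_on_vec_lambda) (auto simp: vector_scalar_mult_def intro!: continuous_intros)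
  show ?thesis
  proof
    show "path ((\<lambda>t. a + t *s v) \<circ> \<delta>)"
      using \<delta>(1) continuous_on_subset[OF cont] by (intro path_continuous_image) auto
    show "pathstart ((\<lambda>t. a + t *s v) \<circ> \<delta>) = a" using \<delta>(3) by (simp add: pathstart_compose)
    show "pathfinish ((\<lambda>t. a + t *s v) \<circ> \<delta>) = b" using \<delta>(4) line by (simp add: pathfinish_compose)
    show "path_image ((\<lambda>t. a + t *s v) \<circ> \<delta>) \<inter> branch_locus P = {}"
      using \<delta>(2) by (auto simp: path_image_compose T_def)
  qed
qed

lemma branch_locus_complement_dense:
  fixes P :: "'n::{finite,linorder} mpoly poly"
  assumes x0: "x0 \<notin> branch_locus P" and U: "open U" "a \<in> U"
  shows "\<exists>b\<in>U. b \<notin> branch_locus P"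
proof (rule ccontr)
  assume no: "\<not> ?thesis"
  define v where "v = x0 - a"
  define T where "T = {t. a + t *s v \<in> branch_locus P}"
  have "a + 1 *s v = x0" by (simp add: v_def)
  then have T: "finite T" unfolding T_def
    by (intro finite_branch_locus_on_line[of a 1]) (use x0 in simp)
  have cont: "continuous_on UNIV (\<lambda>t :: complex. a + t *s v)"
    by (intro continuous_intros continuous_on_vec_lambda) (auto simp: vector_scalar_mult_def intro!: continuous_intros)
  have "open {t. a + t *s v \<in> U}"
    using open_vimage[OF U(1) cont] by (simp add: vimage_def)
  moreover have "0 \<in> {t. a + t *s v \<in> U}" using U(2) by simp
  ultimately obtain e where "e > 0" "ball 0 e \<subseteq> {t. a + t *s v \<in> U}" by (rule openE)
  with no have "ball 0 e \<subseteq> T" by (auto simp: T_def)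
  then have "countable (ball (0::complex) e)"
    using T by (meson countable_finite finite_subset)
  with uncountable_ball[OF \<open>e > 0\<close>, of "0::complex"] show False by simp
qed

text \<open>
By uniqueness of continuation this is the partial function computed by \<open>continues_to \<gamma>\<close>; it is the function
that \<open>monodromy_perm\<close> restricts to the solution germs.
\<close>

definition transport :: "(real \<Rightarrow> complex ^ 'n::finite) \<Rightarrow> 'n germ \<Rightarrow> 'n germ" where
  "transport \<gamma> g = (THE h. continues_to \<gamma> g h)"

lemma transport_eq: "continues_to \<gamma> g h \<Longrightarrow> transport \<gamma> g = h"
  unfolding transport_def using continues_to_unique by blast

lemma transport:
  fixes P :: "'n::{finite,linorder} mpoly poly"
  assumes "path \<gamma>" "path_image \<gamma> \<inter> branch_locus P = {}" "g \<in> solution_germs P (pathstart \<gamma>)"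
  shows "continues_to \<gamma> g (transport \<gamma> g)" "transport \<gamma> g \<in> solution_germs P (pathfinish \<gamma>)"
  using solution_germ_continues[OF assms] transport_eq by metis+

lemma transport_reverse:
  fixes P :: "'n::{finite,linorder} mpoly poly"
  assumes "path \<gamma>" "path_image \<gamma> \<inter> branch_locus P = {}" "g \<in> solution_germs P (pathstart \<gamma>)"
  shows "transport (reversepath \<gamma>) (transport \<gamma> g) = g"
  by (rule transport_eq[OF continues_to_reverse[OF transport(1)[OF assms]]])

lemma transport_join:
  fixes P :: "'n::{finite,linorder} mpoly poly"
  assumes \<gamma>: "path \<gamma>" "path_image \<gamma> \<inter> branch_locus P = {}" "g \<in> solution_germs P (pathstart \<gamma>)"
    and \<delta>: "path \<delta>" "path_image \<delta> \<inter> branch_locus P = {}" "pathfinish \<gamma> = pathstart \<delta>"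
  shows "transport (\<gamma> +++ \<delta>) g = transport \<delta> (transport \<gamma> g)"
  using transport(2)[OF \<gamma>] \<delta>
  by (intro transport_eq continues_to_trans[OF transport(1)[OF \<gamma>]] transport(1)[of _ P]) auto

lemma monodromy_perm_eq: "monodromy_perm P a \<gamma> = (\<lambda>g\<in>solution_germs P a. transport \<gamma> g)"
  by (simp add: monodromy_perm_def transport_def)

lemma monodromy_perm_Bij:
  fixes P :: "'n::{finite,linorder} mpoly poly"
  assumes \<gamma>: "\<gamma> \<in> loops_avoiding (branch_locus P) a"
  shows "monodromy_perm P a \<gamma> \<in> Bij (solution_germs P a)"
proof -
  let ?R = "solution_germs P a"
  have \<gamma>': "path \<gamma>" "path_image \<gamma> \<inter> branch_locus P = {}" "pathstart \<gamma> = a" "pathfinish \<gamma> = a"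
    using \<gamma> by (auto simp: loops_avoiding_def)
  have "bij_betw (transport \<gamma>) ?R ?R"
  proof (rule bij_betw_byWitness[where f' = "transport (reversepath \<gamma>)"])
    show "\<forall>g\<in>?R. transport (reversepath \<gamma>) (transport \<gamma> g) = g"
      using transport_reverse[OF \<gamma>'(1,2)] \<gamma>'(3) by simp
    show "\<forall>g\<in>?R. transport \<gamma> (transport (reversepath \<gamma>) g) = g"
      using transport_reverse[of "reversepath \<gamma>" P] \<gamma>' by simp
    show "transport \<gamma> ` ?R \<subseteq> ?R" using transport(2)[OF \<gamma>'(1,2)] \<gamma>' by auto
    show "transport (reversepath \<gamma>) ` ?R \<subseteq> ?R" using transport(2)[of "reversepath \<gamma>" P] \<gamma>' by auto
  qed
  then have "bij_betw (monodromy_perm P a \<gamma>) ?R ?R"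
    by (rule bij_betw_cong[THEN iffD1, rotated]) (simp add: monodromy_perm_eq)
  then show ?thesis by (simp add: Bij_def monodromy_perm_eq)
qed

lemma finite_solution_germs:
  fixes P :: "'n::{finite,linorder} mpoly poly"
  assumes "x \<notin> branch_locus P"
  shows "finite (solution_germs P x)"
proof -
  from assms obtain r Bs where r: "r > 0" and fin: "finite Bs"
    and hol: "\<And>f. f \<in> Bs \<Longrightarrow> holomorphic_several f (ball x r)"
    and bij: "\<And>z. z \<in> ball x r \<Longrightarrow> bij_betw (\<lambda>f. f z) Bs {w. poly (equation_at P z) w = 0}"
    by (rule local_branches) blast
  have "x \<in> ball x r" using r by simp
  from solution_germs_local[OF hol fin bij this] fin show ?thesis by simp
qed

lemma germ_value_root:
  assumes "g \<in> solution_germs P x"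
  shows "poly (equation_at P x) (germ_value g) = 0"
  using assms eventually_nhds_x_imp_x by (fastforce simp: solution_germs_def)

section \<open>Polynomial functions of the branches\<close>

text \<open>
The polynomial ring with one variable for each element of \<open>R\<close>, as a ring of functions of the vector
\<open>z\<close> of values of the variables. A permutation \<open>\<sigma>\<close> of \<open>R\<close> maps \<open>Q\<close> to \<open>\<lambda>z. Q (z \<circ> \<sigma>)\<close>.
\<close>

inductive_set branch_polys :: "'a set \<Rightarrow> (('a \<Rightarrow> complex) \<Rightarrow> complex) set" for R where
  coord: "g \<in> R \<Longrightarrow> (\<lambda>z. z g) \<in> branch_polys R"
| const: "(\<lambda>z. c) \<in> branch_polys R"
| add: "\<lbrakk>Q \<in> branch_polys R; Q' \<in> branch_polys R\<rbrakk> \<Longrightarrow> (\<lambda>z. Q z + Q' z) \<in> branch_polys R"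
| mult: "\<lbrakk>Q \<in> branch_polys R; Q' \<in> branch_polys R\<rbrakk> \<Longrightarrow> (\<lambda>z. Q z * Q' z) \<in> branch_polys R"

lemma branch_polys_cong:
  assumes "Q \<in> branch_polys R" "\<And>g. g \<in> R \<Longrightarrow> z g = z' g"
  shows "Q z = Q z'"
  using assms by (induction rule: branch_polys.induct) auto

lemma branch_polys_permute:
  assumes "Q \<in> branch_polys R" "\<sigma> ` R \<subseteq> R"
  shows "(\<lambda>z. Q (z \<circ> \<sigma>)) \<in> branch_polys R"
  using assms by (induction rule: branch_polys.induct) (auto intro: branch_polys.intros)

lemma branch_polys_sum:
  "(\<And>i. i \<in> I \<Longrightarrow> Q i \<in> branch_polys R) \<Longrightarrow> (\<lambda>z. \<Sum>i\<in>I. Q i z) \<in> branch_polys R"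
  by (induction I rule: infinite_finite_induct) (auto intro: branch_polys.intros)

lemma branch_polys_power:
  "Q \<in> branch_polys R \<Longrightarrow> (\<lambda>z. Q z ^ k) \<in> branch_polys R"
  by (induction k) (auto intro: branch_polys.intros)

lemma branch_polys_complex_diff_at:
  assumes "Q \<in> branch_polys R" "\<And>g. g \<in> R \<Longrightarrow> complex_diff_at (f g) x"
  shows "complex_diff_at (\<lambda>x. Q (\<lambda>g. f g x)) x"
  using assms by (induction rule: branch_polys.induct) auto

text \<open>
In the application \<open>l\<close> is the leading coefficient of the equation, \<open>z\<close> consists of its roots and \<open>M\<close> is
the sum of the absolute values of its coefficients. The roots may be unbounded near the zeros of \<open>l\<close>, but
their multiples by \<open>l\<close> are not, and a power of \<open>l\<close> distributes these factors over the monomials of \<open>Q\<close>.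
\<close>

lemma branch_polys_growth:
  assumes Q: "Q \<in> branch_polys R"
  shows "\<exists>C\<ge>0. \<exists>k. \<forall>z l M. (\<forall>g\<in>R. cmod (l * z g) \<le> M) \<longrightarrow> cmod l \<le> M \<longrightarrow>
    cmod (l ^ k * Q z) \<le> C * M ^ k"
  using Q
proof (induction rule: branch_polys.induct)
  case (coord g)
  then show ?case by (intro exI[of _ 1] conjI) auto
next
  case (const c)
  show ?case by (intro exI[of _ "cmod c"] conjI exI[of _ 0]) auto
next
  case (add Q Q')
  from add.IH obtain C k C' k' where C: "C \<ge> 0" "C' \<ge> 0"
    and Q: "\<And>z l M. \<lbrakk>\<forall>g\<in>R. cmod (l * z g) \<le> M; cmod l \<le> M\<rbrakk> \<Longrightarrow> cmod (l ^ k * Q z) \<le> C * M ^ k"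
    and Q': "\<And>z l M. \<lbrakk>\<forall>g\<in>R. cmod (l * z g) \<le> M; cmod l \<le> M\<rbrakk> \<Longrightarrow> cmod (l ^ k' * Q' z) \<le> C' * M ^ k'"
    by blast
  show ?case
  proof (intro exI[of _ "C + C'"] conjI exI[of _ "k + k'"] allI impI)
    fix z l M assume lM: "\<forall>g\<in>R. cmod (l * z g) \<le> M" "cmod l \<le> M"
    then have M: "0 \<le> M" by (meson norm_ge_zero order_trans)
    have pw: "cmod l ^ j \<le> M ^ j" for j using lM(2) by (intro power_mono) auto
    have "cmod (l ^ (k + k') * (Q z + Q' z)) = cmod (l ^ k' * (l ^ k * Q z) + l ^ k * (l ^ k' * Q' z))"
      by (simp add: power_add algebra_simps)
    also have "\<dots> \<le> cmod l ^ k' * cmod (l ^ k * Q z) + cmod l ^ k * cmod (l ^ k' * Q' z)"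
      by (rule order.trans[OF norm_triangle_ineq]) (simp add: norm_mult norm_power)
    also have "\<dots> \<le> M ^ k' * (C * M ^ k) + M ^ k * (C' * M ^ k')"
      using M by (intro add_mono mult_mono pw Q[OF lM] Q'[OF lM]) auto
    finally show "cmod (l ^ (k + k') * (Q z + Q' z)) \<le> (C + C') * M ^ (k + k')"
      by (simp add: power_add algebra_simps)
  qed (use C in simp)
next
  case (mult Q Q')
  from mult.IH obtain C k C' k' where C: "C \<ge> 0" "C' \<ge> 0"
    and Q: "\<And>z l M. \<lbrakk>\<forall>g\<in>R. cmod (l * z g) \<le> M; cmod l \<le> M\<rbrakk> \<Longrightarrow> cmod (l ^ k * Q z) \<le> C * M ^ k"
    and Q': "\<And>z l M. \<lbrakk>\<forall>g\<in>R. cmod (l * z g) \<le> M; cmod l \<le> M\<rbrakk> \<Longrightarrow> cmod (l ^ k' * Q' z) \<le> C' * M ^ k'"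
    by blast
  show ?case
  proof (intro exI[of _ "C * C'"] conjI exI[of _ "k + k'"] allI impI)
    fix z l M assume lM: "\<forall>g\<in>R. cmod (l * z g) \<le> M" "cmod l \<le> M"
    then have M: "0 \<le> M" by (meson norm_ge_zero order_trans)
    have "cmod (l ^ (k + k') * (Q z * Q' z)) = cmod (l ^ k * Q z) * cmod (l ^ k' * Q' z)"
      by (simp add: power_add norm_mult mult_ac)
    also have "\<dots> \<le> (C * M ^ k) * (C' * M ^ k')"
      using M C by (intro mult_mono Q[OF lM] Q'[OF lM]) auto
    finally show "cmod (l ^ (k + k') * (Q z * Q' z)) \<le> (C * C') * M ^ (k + k')"
      by (simp add: power_add mult_ac)
  qed (use C in simp)
qed

text \<open>
For \<open>\<bar>w\<bar> > 1\<close>, divide the equation by \<open>w\<^sup>n\<^sup>-\<^sup>1\<close> and solve it for \<open>P\<^sub>n w\<close>.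
\<close>

lemma lead_coeff_times_root_bound:
  assumes "poly (equation_at P x) w = 0"
  shows "cmod (mpoly_eval (lead_coeff P) x * w) \<le> (\<Sum>i\<le>degree P. cmod (mpoly_eval (coeff P i) x))"
proof -
  let ?c = "\<lambda>i. mpoly_eval (coeff P i) x" and ?n = "degree P"
  have le: "cmod (?c ?n) \<le> (\<Sum>i\<le>?n. cmod (?c i))"
    by (rule member_le_sum[of ?n "{..?n}" "\<lambda>i. cmod (?c i)"]) auto
  show ?thesis
  proof (cases "cmod w \<le> 1")
    case True
    then have "cmod (?c ?n * w) \<le> cmod (?c ?n)"
      by (simp add: norm_mult mult_left_le)
    with le show ?thesis by simp
  next
    case False
    have root: "?c ?n * w ^ ?n = - (\<Sum>i<?n. ?c i * w ^ i)"
      using assms unfolding poly_equation_at by (simp add: lessThan_Suc_atMost[symmetric] eq_neg_iff_add_eq_0 add.commute)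
    show ?thesis
    proof (cases ?n)
      case 0
      with root have "?c ?n = 0" by simp
      then show ?thesis by (simp add: sum_nonneg)
    next
      case (Suc m)
      have "cmod (?c ?n * w) * cmod w ^ m = cmod (?c ?n * w ^ ?n)"
        by (simp add: Suc norm_mult norm_power)
      also have "\<dots> \<le> (\<Sum>i<?n. cmod (?c i * w ^ i))"
        unfolding root norm_minus_cancel by (rule norm_sum)
      also have "\<dots> \<le> (\<Sum>i<?n. cmod (?c i) * cmod w ^ m)"
        using False Suc by (intro sum_mono) (auto simp: norm_mult norm_power intro!: mult_left_mono power_increasing)
      also have "\<dots> = (\<Sum>i<?n. cmod (?c i)) * cmod w ^ m"
        by (simp add: sum_distrib_right)
      finally have "cmod (?c ?n * w) \<le> (\<Sum>i<?n. cmod (?c i))"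
        by (rule mult_right_le_imp_le) (rule zero_less_power, use False in linarith)
      also have "\<dots> \<le> (\<Sum>i\<le>?n. cmod (?c i))" by (rule sum_mono2) auto
      finally show ?thesis .
    qed
  qed
qed

lemma branch_functions:
  fixes P :: "'n::{finite,linorder} mpoly poly"
  assumes x: "x \<notin> branch_locus P"
  obtains r f where "r > 0" "ball x r \<inter> branch_locus P = {}"
    "\<And>g. g \<in> solution_germs P x \<Longrightarrow> holomorphic_several (f g) (ball x r) \<and> germ_at x (f g) = g"
proof -
  from x obtain r Bs where r: "r > 0" "ball x r \<inter> branch_locus P = {}" and fin: "finite Bs"
    and hol: "\<And>f. f \<in> Bs \<Longrightarrow> holomorphic_several f (ball x r)"
    and bij: "\<And>z. z \<in> ball x r \<Longrightarrow> bij_betw (\<lambda>f. f z) Bs {w. poly (equation_at P z) w = 0}"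
    by (rule local_branches) blast
  have "solution_germs P x = germ_at x ` Bs"
    using solution_germs_local[OF hol fin bij] r(1) by simp
  then have "\<forall>g\<in>solution_germs P x. \<exists>f. holomorphic_several f (ball x r) \<and> germ_at x f = g"
    using hol by auto
  then obtain f where "\<forall>g\<in>solution_germs P x. holomorphic_several (f g) (ball x r) \<and> germ_at x (f g) = g"
    by (rule bchoice[THEN exE])
  with r show ?thesis by (intro that[of r f]) auto
qed

lemma transport_linepath:
  assumes f: "holomorphic_several f (ball x r)" and z: "z \<in> ball x r"
  shows "transport (linepath x z) (germ_at x f) = germ_at z f"
proof -
  have "x \<in> ball x r" using z by (auto intro: le_less_trans[OF zero_le_dist])
  then have "path_image (linepath x z) \<subseteq> ball x r"
    using z by (simp add: closed_segment_subset)
  from continues_to_within[OF f open_ball path_linepath this] show ?thesis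
    by (intro transport_eq) simp
qed

section \<open>Invariants of the monodromy group\<close>

text \<open>
Let \<open>F x\<close> be the value of \<open>Q\<close> at the branches transported from \<open>x\<^sub>0\<close> to \<open>x\<close>. Two paths to \<open>x\<close> differ by a
loop, which permutes the branches by a monodromy permutation, so invariance makes \<open>F x\<close> independent
of the path. Near every point \<open>F\<close> is a polynomial in local branches, hence holomorphic, and it becomes a
polynomial after multiplication by a power of the leading coefficient.
\<close>

lemma monodromy_invariant_is_rational:
  fixes P :: "'n::{finite,linorder} mpoly poly"
  assumes x0: "x0 \<notin> branch_locus P"
    and r: "r > 0" "ball x0 r \<inter> branch_locus P = {}"
    and f: "\<And>g. g \<in> solution_germs P x0 \<Longrightarrow> holomorphic_several (f g) (ball x0 r) \<and> germ_at x0 (f g) = g"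
    and Q: "Q \<in> branch_polys (solution_germs P x0)"
    and inv: "\<And>\<gamma> z. \<gamma> \<in> loops_avoiding (branch_locus P) x0 \<Longrightarrow> Q (z \<circ> monodromy_perm P x0 \<gamma>) = Q z"
  shows "\<exists>p q. mpoly_eval q x0 \<noteq> 0 \<and>
    (\<forall>\<^sub>F x in nhds x0. Q (\<lambda>g. f g x) = mpoly_eval p x / mpoly_eval q x)"
proof -
  let ?R = "solution_germs P x0" and ?B = "branch_locus P"
  let ?to = "\<lambda>\<delta> x. path \<delta> \<and> pathstart \<delta> = x0 \<and> pathfinish \<delta> = x \<and> path_image \<delta> \<inter> ?B = {}"
  have "\<forall>x. x \<notin> ?B \<longrightarrow> (\<exists>\<delta>. ?to \<delta> x)"
    using branch_locus_complement_connected[OF x0] by metis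
  then obtain \<Gamma> where \<Gamma>: "\<And>x. x \<notin> ?B \<Longrightarrow> ?to (\<Gamma> x) x" by metis
  define F where "F x = Q (\<lambda>g. germ_value (transport (\<Gamma> x) g))" for x
  have F: "F x = Q (\<lambda>g. germ_value (transport \<delta> g))" if \<delta>: "?to \<delta> x" for \<delta> x
  proof -
    have x: "x \<notin> ?B" using \<delta> pathfinish_in_path_image[of \<delta>] by auto
    note \<Gamma>x = \<Gamma>[OF x]
    \<comment> \<open>Going to \<open>x\<close> along \<open>\<delta>\<close> after this loop has the same effect as going along \<open>\<Gamma> x\<close>.\<close>
    define loop where "loop = \<Gamma> x +++ reversepath \<delta>"
    have loop: "loop \<in> loops_avoiding ?B x0"
      using \<Gamma>x \<delta> by (auto simp: loop_def loops_avoiding_def path_image_join)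
    have "Q (\<lambda>g. germ_value (transport \<delta> g)) =
        Q ((\<lambda>g. germ_value (transport \<delta> g)) \<circ> monodromy_perm P x0 loop)"
      using inv[OF loop] by simp
    also have "\<dots> = F x"
      unfolding F_def
    proof (rule branch_polys_cong[OF Q])
      fix g assume g: "g \<in> ?R"
      have tg: "transport (\<Gamma> x) g \<in> solution_germs P x"
        using transport(2)[of "\<Gamma> x" P g] \<Gamma>x g by simp
      have "transport loop g = transport (reversepath \<delta>) (transport (\<Gamma> x) g)"
        unfolding loop_def using \<Gamma>x \<delta> g by (intro transport_join[of _ P]) auto
      then have "transport \<delta> (transport loop g) = transport (\<Gamma> x) g"
        using transport_reverse[of "reversepath \<delta>" P "transport (\<Gamma> x) g"] \<delta> tg by simp
      then show "((\<lambda>g. germ_value (transport \<delta> g)) \<circ> monodromy_perm P x0 loop) g =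
          germ_value (transport (\<Gamma> x) g)"
        using g by (simp add: monodromy_perm_eq)
    qed
    finally show ?thesis by simp
  qed
  have local: "F z = Q (\<lambda>g. f' (transport \<delta> g) z)"
    if \<delta>: "?to \<delta> x" and r': "r' > 0" "ball x r' \<inter> ?B = {}" and z: "z \<in> ball x r'"
      and f': "\<And>g. g \<in> solution_germs P x \<Longrightarrow> holomorphic_several (f' g) (ball x r') \<and> germ_at x (f' g) = g"
    for \<delta> x r' f' z
  proof -
    have seg: "path_image (linepath x z) \<inter> ?B = {}"
      using closed_segment_subset[of x "ball x r'" z] r' z by auto
    have "?to (\<delta> +++ linepath x z) z"
      using \<delta> seg by (auto simp: path_image_join)
    then have "F z = Q (\<lambda>g. germ_value (transport (\<delta> +++ linepath x z) g))" by (rule F)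
    also have "\<dots> = Q (\<lambda>g. f' (transport \<delta> g) z)"
    proof (rule branch_polys_cong[OF Q])
      fix g assume g: "g \<in> ?R"
      have tg: "transport \<delta> g \<in> solution_germs P x"
        using transport(2)[of \<delta> P g] \<delta> g by simp
      have "transport (\<delta> +++ linepath x z) g = transport (linepath x z) (transport \<delta> g)"
        using \<delta> seg g by (intro transport_join[of _ P]) auto
      also have "\<dots> = germ_at z (f' (transport \<delta> g))"
        using f'[OF tg] transport_linepath[of "f' (transport \<delta> g)" x r' z] z by simp
      finally show "germ_value (transport (\<delta> +++ linepath x z) g) = f' (transport \<delta> g) z" by simp
    qed
    finally show ?thesis .
  qed
  have F0: "F z = Q (\<lambda>g. f g z)" if z: "z \<in> ball x0 r" for z
  proof -
    have const: "?to (linepath x0 x0) x0" using x0 by simp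
    have "F z = Q (\<lambda>g. f (transport (linepath x0 x0) g) z)"
      by (rule local[OF const r z f])
    also have "\<dots> = Q (\<lambda>g. f g z)"
    proof (rule branch_polys_cong[OF Q])
      fix g assume g: "g \<in> ?R"
      have "transport (linepath x0 x0) g = g"
        using transport_linepath[of "f g" x0 r x0] f[OF g] r(1) by simp
      then show "f (transport (linepath x0 x0) g) z = f g z" by simp
    qed
    finally show ?thesis .
  qed
  have holF: "complex_diff_at F x" if x: "x \<notin> ?B" for x
  proof -
    obtain r' f' where r': "r' > 0" "ball x r' \<inter> ?B = {}"
      and f': "\<And>g. g \<in> solution_germs P x \<Longrightarrow> holomorphic_several (f' g) (ball x r') \<and> germ_at x (f' g) = g"
      by (rule branch_functions[OF x]) blast
    have "complex_diff_at (\<lambda>z. Q (\<lambda>g. f' (transport (\<Gamma> x) g) z)) x"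
    proof (rule branch_polys_complex_diff_at[OF Q])
      fix g assume "g \<in> ?R"
      then have "transport (\<Gamma> x) g \<in> solution_germs P x"
        using transport(2)[of "\<Gamma> x" P g] \<Gamma>[OF x] by simp
      from f'[OF this] show "complex_diff_at (f' (transport (\<Gamma> x) g)) x"
        using r'(1) by (simp add: holomorphic_several_iff)
    qed
    moreover have "\<forall>\<^sub>F z in nhds x. F z = Q (\<lambda>g. f' (transport (\<Gamma> x) g) z)"
      unfolding eventually_nhds
      using local[OF \<Gamma>[OF x] r' _ f'] r'(1) by (intro exI[of _ "ball x r'"]) auto
    ultimately show ?thesis by (rule complex_diff_at_cong)
  qed
  obtain D where D: "?B = {x. mpoly_eval D x = 0}" by (rule branch_locus_hypersurface)
  let ?l = "mpoly_eval (lead_coeff P)"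
  obtain C k where C: "C \<ge> 0" and bound: "\<And>z l M. \<lbrakk>\<forall>g\<in>?R. cmod (l * z g) \<le> M; cmod l \<le> M\<rbrakk> \<Longrightarrow>
      cmod (l ^ k * Q z) \<le> C * M ^ k"
    using branch_polys_growth[OF Q] by blast
  have "\<exists>p. \<forall>\<^sub>F x in nhds x0. ?l x ^ k * F x = mpoly_eval p x"
  proof (rule polynomial_growth_imp_polynomial[where D = D and C = C and S = "{..degree P}" and c = "coeff P" and k = k])
    show "holomorphic_several (\<lambda>x. ?l x ^ k * F x) {x. mpoly_eval D x \<noteq> 0}"
      unfolding holomorphic_several_iff
    proof
      fix x assume "x \<in> {x. mpoly_eval D x \<noteq> 0}"
      then have "x \<notin> ?B" by (simp add: D)
      then show "complex_diff_at (\<lambda>x. ?l x ^ k * F x) x"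
        by (intro complex_diff_at_mult complex_diff_at_power complex_diff_at_mpoly_eval holF)
    qed
    show "mpoly_eval D x0 \<noteq> 0" using x0 by (simp add: D)
    fix x assume "mpoly_eval D x \<noteq> 0"
    then have x: "x \<notin> ?B" by (simp add: D)
    show "cmod (?l x ^ k * F x) \<le> C * (\<Sum>i\<le>degree P. cmod (mpoly_eval (coeff P i) x)) ^ k"
      unfolding F_def
    proof (rule bound)
      show "\<forall>g\<in>?R. cmod (?l x * germ_value (transport (\<Gamma> x) g)) \<le> (\<Sum>i\<le>degree P. cmod (mpoly_eval (coeff P i) x))"
      proof
        fix g assume "g \<in> ?R"
        then have "transport (\<Gamma> x) g \<in> solution_germs P x"
          using transport(2)[of "\<Gamma> x" P g] \<Gamma>[OF x] by simp
        from lead_coeff_times_root_bound[OF germ_value_root[OF this]]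
        show "cmod (?l x * germ_value (transport (\<Gamma> x) g)) \<le> (\<Sum>i\<le>degree P. cmod (mpoly_eval (coeff P i) x))" .
      qed
      show "cmod (?l x) \<le> (\<Sum>i\<le>degree P. cmod (mpoly_eval (coeff P i) x))"
        by (rule member_le_sum[of "degree P" "{..degree P}" "\<lambda>i. cmod (mpoly_eval (coeff P i) x)"]) auto
    qed
  qed (use C in auto)
  then obtain p where p: "\<forall>\<^sub>F x in nhds x0. ?l x ^ k * F x = mpoly_eval p x" by blast
  obtain q where q: "(\<lambda>x. ?l x ^ k) = mpoly_eval q"
    using polynomial_map_power[OF polynomial_map_mpoly_eval, of "lead_coeff P" k]
    unfolding polynomial_map_def by blast
  have ql: "mpoly_eval q x = ?l x ^ k" for x using fun_cong[OF q, of x] by simp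
  have "mpoly_eval q x0 \<noteq> 0" using x0 by (simp add: ql not_branch_locus_iff)
  moreover have "\<forall>\<^sub>F x in nhds x0. x \<in> ball x0 r" using r(1) by (intro eventually_nhds_in_open) auto
  with p have "\<forall>\<^sub>F x in nhds x0. Q (\<lambda>g. f g x) = mpoly_eval p x / mpoly_eval q x"
  proof eventually_elim
    case (elim x)
    then have "x \<notin> ?B" using r(2) by auto
    then have "mpoly_eval q x \<noteq> 0" by (simp add: ql not_branch_locus_iff)
    with elim(1) F0[OF elim(2)] show ?case by (simp add: ql field_simps)
  qed
  ultimately show ?thesis by blast
qed

section \<open>Lagrange resolvents and solvable groups\<close>

definition invariant_under :: "('a \<Rightarrow> 'a) set \<Rightarrow> (('a \<Rightarrow> complex) \<Rightarrow> complex) \<Rightarrow> bool" where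
  "invariant_under S Q \<longleftrightarrow> (\<forall>\<sigma>\<in>S. \<forall>z. Q (z \<circ> \<sigma>) = Q z)"

text \<open>
The exponent is at least \<open>2\<close> because it will be the degree of a root extraction.
\<close>

lemma funpow_returns:
  assumes R: "finite R" and h: "bij_betw h R R"
  obtains m where "m \<ge> (2::nat)" "\<And>g. g \<in> R \<Longrightarrow> (h ^^ m) g = g"
proof -
  define h' where "h' x = (if x \<in> R then h x else x)" for x
  have "h' permutes R"
    using h by (intro bij_imp_permutes) (auto simp: h'_def cong: bij_betw_cong)
  then have "permutation h'" using R by (auto simp: permutation_permutes)
  then obtain n where n: "(h' ^^ n) = id" "n > 1"
    using permutation_is_nilpotent'[where m = 1] by blast
  have maps: "h x \<in> R" if "x \<in> R" for x using h that by (auto simp: bij_betw_def)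
  have eq: "(h ^^ k) x = (h' ^^ k) x \<and> (h ^^ k) x \<in> R" if "x \<in> R" for k x
    using that by (induction k) (auto simp: h'_def maps)
  show ?thesis using n eq by (intro that[of n]) auto
qed

lemma root_of_unity_sum:
  assumes m: "m \<ge> 1" and k: "k < m"
  shows "(\<Sum>j<m. (exp (2 * of_real pi * \<i> / of_nat m) ^ (j * k))) = (if k = 0 then of_nat m else (0::complex))"
proof (cases "k = 0")
  case False
  let ?\<zeta> = "exp (2 * of_real pi * \<i> / of_nat m) :: complex"
  have pw: "?\<zeta> ^ j = exp (2 * of_real pi * \<i> * of_nat j / of_nat m)" for j
    by (simp add: exp_of_nat_mult[symmetric] mult_ac)
  have "?\<zeta> ^ k \<noteq> 1"
    unfolding pw complex_root_unity_eq_1[OF m] using False k by (auto dest: dvd_imp_le)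
  moreover have "?\<zeta> ^ (k * m) = 1"
    unfolding pw complex_root_unity_eq_1[OF m] by simp
  then have "(?\<zeta> ^ k) ^ m = 1" by (simp only: power_mult)
  ultimately have "(\<Sum>j<m. (?\<zeta> ^ k) ^ j) = 0" by (simp add: geometric_sum)
  then show ?thesis using False by (simp add: power_mult[symmetric] mult.commute)
qed simp

text \<open>
The predicate \<open>rep\<close> is any property that passes from a power to its root and from terms to their sum.
With \<open>h\<^sup>m = 1\<close> on \<open>R\<close> and a primitive \<open>m\<close>-th root of unity \<open>\<zeta>\<close>, the resolvents
\<open>L\<^sub>j = (1/m) \<Sum>\<^sub>k \<zeta>\<^sup>j\<^sup>k h\<^sup>k Q\<close> are eigenvectors of \<open>h\<close> whose sum is \<open>Q\<close>. Their \<open>m\<close>-th powers are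
invariant under \<open>h\<close>, and under \<open>S\<close> because all translates \<open>h\<^sup>k Q\<close> are.
\<close>

lemma Lagrange_resolvents:
  fixes R :: "'a set" and rep :: "(('a \<Rightarrow> complex) \<Rightarrow> complex) \<Rightarrow> bool"
  assumes R: "finite R" and h: "bij_betw h R R" and Q: "Q \<in> branch_polys R"
    and S: "\<And>k. invariant_under S (\<lambda>z. Q (z \<circ> (h ^^ k)))"
    and rep_inv: "\<And>Q. \<lbrakk>Q \<in> branch_polys R; invariant_under (insert h S) Q\<rbrakk> \<Longrightarrow> rep Q"
    and rep_root: "\<And>Q m. \<lbrakk>Q \<in> branch_polys R; m \<ge> 2; rep (\<lambda>z. Q z ^ m)\<rbrakk> \<Longrightarrow> rep Q"
    and rep_sum: "\<And>Q m. \<lbrakk>\<And>j. j < m \<Longrightarrow> Q j \<in> branch_polys R; \<And>j. j < m \<Longrightarrow> rep (Q j)\<rbrakk>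
      \<Longrightarrow> rep (\<lambda>z. \<Sum>j<(m::nat). Q j z)"
  shows "rep Q"
proof -
  obtain m where m: "m \<ge> 2" "\<And>g. g \<in> R \<Longrightarrow> (h ^^ m) g = g"
    by (rule funpow_returns[OF R h]) blast
  define \<zeta> :: complex where "\<zeta> = exp (2 * of_real pi * \<i> / of_nat m)"
  have \<zeta>m: "\<zeta> ^ m = 1"
    using m(1) by (simp add: \<zeta>_def exp_of_nat_mult[symmetric])
  \<comment> \<open>\<open>T k\<close> is the translate \<open>h\<^sup>k Q\<close>, and \<open>L j\<close> is the \<open>j\<close>-th resolvent.\<close>
  define T where "T k z = Q (z \<circ> (h ^^ k))" for k z
  define L where "L j z = (\<Sum>k<m. (\<zeta> ^ (j * k) / of_nat m) * T k z)" for j z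
  have hR: "(h ^^ k) ` R \<subseteq> R" for k
    using h by (induction k) (auto simp: bij_betw_def)
  have T_poly: "T k \<in> branch_polys R" for k
    unfolding T_def by (rule branch_polys_permute[OF Q hR])
  have L_poly: "L j \<in> branch_polys R" for j
    unfolding L_def[abs_def]
    by (intro branch_polys_sum branch_polys.mult branch_polys.const T_poly)
  have Tm: "T m z = T 0 z" for z
    unfolding T_def by (rule branch_polys_cong[OF Q]) (use m(2) in simp)
  have Th: "T k (z \<circ> h) = T (Suc k) z" for k z
    by (simp add: T_def comp_assoc)
  have Lh: "\<zeta> ^ j * L j (z \<circ> h) = L j z" for j z
  proof -
    \<comment> \<open>Applying \<open>h\<close> shifts the summation index by one, cyclically since \<open>h\<^sup>m = 1\<close>.\<close>
    let ?a = "\<lambda>k. (\<zeta> ^ (j * k) / of_nat m) * T k z"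
    have step: "\<zeta> ^ j * L j (z \<circ> h) = (\<Sum>k<m. ?a (Suc k))"
      by (simp add: L_def Th sum_distrib_left power_add mult_ac)
    have shift: "(\<Sum>k<m. ?a (Suc k)) + ?a 0 = (\<Sum>k<m. ?a k) + ?a m"
      using sum.lessThan_Suc_shift[of ?a m] sum.lessThan_Suc[of ?a m] by simp
    have "?a m = ?a 0"
      using Tm \<zeta>m by (simp add: power_mult mult.commute[of j m])
    from shift[unfolded this] have "(\<Sum>k<m. ?a (Suc k)) = (\<Sum>k<m. ?a k)"
      by (rule add_right_imp_eq)
    with step show ?thesis by (simp add: L_def)
  qed
  have "rep (L j)" for j
  proof (rule rep_root[OF L_poly m(1)])
    show "rep (\<lambda>z. L j z ^ m)"
    proof (rule rep_inv)
      show "(\<lambda>z. L j z ^ m) \<in> branch_polys R" by (rule branch_polys_power[OF L_poly])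
      have "L j (z \<circ> h) ^ m = L j z ^ m" for z
      proof -
        have "L j z ^ m = (\<zeta> ^ m) ^ j * L j (z \<circ> h) ^ m"
          unfolding Lh[of j z, symmetric] by (simp add: power_mult_distrib power_mult[symmetric] mult.commute)
        then show ?thesis using \<zeta>m by simp
      qed
      moreover have "L j (z \<circ> \<sigma>) = L j z" if "\<sigma> \<in> S" for z \<sigma>
        using S that unfolding L_def T_def invariant_under_def by (auto intro!: sum.cong)
      ultimately show "invariant_under (insert h S) (\<lambda>z. L j z ^ m)"
        by (auto simp: invariant_under_def)
    qed
  qed
  then have "rep (\<lambda>z. \<Sum>j<m. L j z)" by (intro rep_sum L_poly)
  moreover have "(\<Sum>j<m. L j z) = Q z" for z
  proof -
    have "(\<Sum>j<m. L j z) = (\<Sum>k<m. \<Sum>j<m. (\<zeta> ^ (j * k) / of_nat m) * T k z)"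
      unfolding L_def by (rule sum.swap)
    also have "\<dots> = (\<Sum>k<m. (\<Sum>j<m. \<zeta> ^ (j * k)) * (T k z / of_nat m))"
      by (simp add: sum_distrib_right sum_divide_distrib)
    also have "\<dots> = (\<Sum>k<m. (if k = 0 then of_nat m else 0) * (T k z / of_nat m))"
      using root_of_unity_sum[of m] m(1) by (intro sum.cong) (simp_all add: \<zeta>_def)
    also have "\<dots> = (\<Sum>k<m. if k = 0 then T 0 z else 0)"
      using m(1) by (intro sum.cong) auto
    also have "\<dots> = T 0 z" using m(1) by (simp add: sum.delta)
    finally show ?thesis by (simp add: T_def)
  qed
  ultimately show ?thesis by simp
qed

lemma commute_modulo_normal:
  assumes K: "K \<lhd> G" and ab: "comm_group (G Mod K)" and x: "x \<in> carrier G" and y: "y \<in> carrier G"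
  shows "\<exists>k\<in>K. x \<otimes>\<^bsub>G\<^esub> y = (y \<otimes>\<^bsub>G\<^esub> x) \<otimes>\<^bsub>G\<^esub> k"
proof -
  interpret K: normal K G by (rule K)
  interpret ab: comm_group "G Mod K" by (rule ab)
  have "K #>\<^bsub>G\<^esub> x \<in> carrier (G Mod K)" "K #>\<^bsub>G\<^esub> y \<in> carrier (G Mod K)"
    using x y by (auto simp: FactGroup_def RCOSETS_def)
  from ab.m_comm[OF this] have "K #>\<^bsub>G\<^esub> (x \<otimes>\<^bsub>G\<^esub> y) = K #>\<^bsub>G\<^esub> (y \<otimes>\<^bsub>G\<^esub> x)"
    using x y by (simp add: FactGroup_def K.rcos_sum)
  moreover have "x \<otimes>\<^bsub>G\<^esub> y \<in> K #>\<^bsub>G\<^esub> (x \<otimes>\<^bsub>G\<^esub> y)"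
    using x y K.subgroup_axioms by (intro K.rcos_self) auto
  moreover have "K #>\<^bsub>G\<^esub> (y \<otimes>\<^bsub>G\<^esub> x) = (y \<otimes>\<^bsub>G\<^esub> x) <#\<^bsub>G\<^esub> K"
    using x y K.coset_eq by simp
  ultimately show ?thesis by (auto simp: l_coset_def)
qed

text \<open>
Going up the solvable series, it is enough to pass from \<open>H\<close> to a normal subgroup \<open>K\<close> with abelian
quotient: if all \<open>H\<close>-invariant polynomials have the property \<open>rep\<close>, so do all \<open>K\<close>-invariant ones. The elements
of \<open>H\<close> are removed one at a time from the set \<open>K \<union> T\<close> under which invariance is required, by the
Lagrange resolvents of the element removed.
\<close>

lemma solvable_resolvents:
  fixes R :: "'a set" and rep :: "(('a \<Rightarrow> complex) \<Rightarrow> complex) \<Rightarrow> bool"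
  assumes solv: "solvable_seq (BijGroup R\<lparr>carrier := X\<rparr>) H" and X: "X \<subseteq> Bij R" and R: "finite R"
    and rep_root: "\<And>Q m. \<lbrakk>Q \<in> branch_polys R; m \<ge> 2; rep (\<lambda>z. Q z ^ m)\<rbrakk> \<Longrightarrow> rep Q"
    and rep_sum: "\<And>Q m. \<lbrakk>\<And>j. j < m \<Longrightarrow> Q j \<in> branch_polys R; \<And>j. j < m \<Longrightarrow> rep (Q j)\<rbrakk>
      \<Longrightarrow> rep (\<lambda>z. \<Sum>j<(m::nat). Q j z)"
    and rep_inv: "\<And>Q. \<lbrakk>Q \<in> branch_polys R; invariant_under H Q\<rbrakk> \<Longrightarrow> rep Q"
    and Q: "Q \<in> branch_polys R"
  shows "rep Q"
  using solv rep_inv Q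
proof (induction arbitrary: Q rule: solvable_seq.induct)
  case unity
  have "invariant_under {\<one>\<^bsub>BijGroup R\<lparr>carrier := X\<rparr>\<^esub>} Q"
    unfolding invariant_under_def
    by (auto simp: BijGroup_def intro!: branch_polys_cong[OF unity(2)])
  with unity show ?case by blast
next
  case (extension K H)
  let ?G = "BijGroup R\<lparr>carrier := X\<rparr>"
  let ?H = "?G\<lparr>carrier := H\<rparr>"
  have HX: "H \<subseteq> X" using subgroup.subset[OF extension(3)] by simp
  then have HB: "H \<subseteq> Bij R" using X by blast
  have KH: "K \<subseteq> H" using normal_imp_subgroup[OF extension(2)] subgroup.subset by fastforce
  have bij: "bij_betw \<sigma> R R" if "\<sigma> \<in> H" for \<sigma> using that HB by (auto simp: Bij_def)
  have mapsto: "\<sigma> g \<in> R" if "\<sigma> \<in> H" "g \<in> R" for \<sigma> g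
    using bij[OF that(1)] that(2) by (auto simp: bij_betw_def)
  have mult: "(\<sigma> \<otimes>\<^bsub>?H\<^esub> \<tau>) g = \<sigma> (\<tau> g)" if "\<sigma> \<in> Bij R" "\<tau> \<in> Bij R" "g \<in> R" for \<sigma> \<tau> g
    using that by (simp add: BijGroup_def compose_eq)
  have mult_Bij: "\<sigma> \<otimes>\<^bsub>?H\<^esub> \<tau> \<in> Bij R" if "\<sigma> \<in> Bij R" "\<tau> \<in> Bij R" for \<sigma> \<tau>
    using that by (simp add: BijGroup_def compose_Bij)
  have commute: "\<exists>k\<in>K. \<forall>g\<in>R. \<sigma> (\<tau> g) = \<tau> (\<sigma> (k g))" if st: "\<sigma> \<in> H" "\<tau> \<in> H" for \<sigma> \<tau>
  proof -
    obtain k where k: "k \<in> K" "\<sigma> \<otimes>\<^bsub>?H\<^esub> \<tau> = (\<tau> \<otimes>\<^bsub>?H\<^esub> \<sigma>) \<otimes>\<^bsub>?H\<^esub> k"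
      using commute_modulo_normal[OF extension(2,4), of \<sigma> \<tau>] st by auto
    have B: "\<sigma> \<in> Bij R" "\<tau> \<in> Bij R" "k \<in> Bij R" using st k(1) HB KH by auto
    have "\<sigma> (\<tau> g) = \<tau> (\<sigma> (k g))" if g: "g \<in> R" for g
    proof -
      have "\<sigma> (\<tau> g) = (\<sigma> \<otimes>\<^bsub>?H\<^esub> \<tau>) g" using mult[OF B(1,2) g] by simp
      also have "\<dots> = (\<tau> \<otimes>\<^bsub>?H\<^esub> \<sigma>) (k g)"
        unfolding k(2) by (rule mult[OF mult_Bij[OF B(2,1)] B(3) g])
      also have "\<dots> = \<tau> (\<sigma> (k g))"
        using mapsto[of k g] g k(1) KH by (intro mult B) auto
      finally show ?thesis .
    qed
    with k(1) show ?thesis by blast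
  qed
  have translate: "invariant_under T (\<lambda>z. Q (z \<circ> (h ^^ n)))"
    if T: "K \<subseteq> T" "T \<subseteq> H" and h: "h \<in> H" and Q: "Q \<in> branch_polys R" "invariant_under T Q" for T h Q n
  proof (induction n)
    case 0
    then show ?case using Q(2) by simp
  next
    case (Suc n)
    let ?Q = "\<lambda>z. Q (z \<circ> (h ^^ n))"
    have "(h ^^ n) ` R \<subseteq> R" using mapsto[OF h] by (induction n) auto
    then have Qn: "?Q \<in> branch_polys R" by (rule branch_polys_permute[OF Q(1)])
    have inv: "?Q (z \<circ> \<sigma>) = ?Q z" if "\<sigma> \<in> T" for \<sigma> z
      using Suc that unfolding invariant_under_def by blast
    show ?case
      unfolding invariant_under_def
    proof (intro ballI allI)
      fix \<sigma> z assume \<sigma>: "\<sigma> \<in> T"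
      obtain k where k: "k \<in> K" "\<And>g. g \<in> R \<Longrightarrow> \<sigma> (h g) = h (\<sigma> (k g))"
        using commute[of \<sigma> h] \<sigma> T(2) h by blast
      have "Q (z \<circ> \<sigma> \<circ> (h ^^ Suc n)) = ?Q (z \<circ> \<sigma> \<circ> h)"
        by (simp add: comp_assoc)
      also have "\<dots> = ?Q (z \<circ> h \<circ> \<sigma> \<circ> k)"
        by (rule branch_polys_cong[OF Qn]) (simp add: k(2))
      also have "\<dots> = ?Q (z \<circ> h \<circ> \<sigma>)"
        by (rule inv) (use k(1) T(1) in blast)
      also have "\<dots> = ?Q (z \<circ> h)"
        by (rule inv[OF \<sigma>])
      finally show "Q (z \<circ> \<sigma> \<circ> (h ^^ Suc n)) = Q (z \<circ> (h ^^ Suc n))"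
        by (simp add: comp_assoc)
    qed
  qed
  have "finite (Bij R)"
    by (rule finite_subset[OF _ finite_PiE[of R "\<lambda>_. R"]])
       (use R in \<open>auto simp: Bij_def PiE_def bij_betw_def\<close>)
  then have finH: "finite H" using HB finite_subset by blast
  have descend: "\<forall>Q\<in>branch_polys R. invariant_under K Q \<longrightarrow> rep Q"
    if "finite T" "T \<subseteq> H" "\<forall>Q\<in>branch_polys R. invariant_under (K \<union> T) Q \<longrightarrow> rep Q" for T
    using that
  proof (induction T rule: finite_induct)
    case empty
    then show ?case by simp
  next
    case (insert h T)
    have "rep Q" if Q: "Q \<in> branch_polys R" "invariant_under (K \<union> T) Q" for Q
    proof (rule Lagrange_resolvents[where R = R and h = h and S = "K \<union> T" and rep = rep])
      show "rep Q'" if "Q' \<in> branch_polys R" "m \<ge> 2" "rep (\<lambda>z. Q' z ^ m)" for Q' m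
        using that by (rule rep_root)
      show "rep (\<lambda>z. \<Sum>j<m. Q' j z)"
        if "\<And>j. j < m \<Longrightarrow> Q' j \<in> branch_polys R" "\<And>j. j < m \<Longrightarrow> rep (Q' j)" for Q' and m :: nat
        using that by (rule rep_sum)
      show "bij_betw h R R" using bij insert.prems(1) by blast
      show "invariant_under (K \<union> T) (\<lambda>z. Q (z \<circ> (h ^^ k)))" for k
        using translate[of "K \<union> T" h Q k] KH insert.prems(1) Q by blast
      show "rep Q'" if "Q' \<in> branch_polys R" "invariant_under (insert h (K \<union> T)) Q'" for Q'
        using insert.prems(2) that by simp
    qed (rule R, rule Q(1))
    then show ?case using insert.IH insert.prems(1) by blast
  qed
  have "K \<union> H = H" using KH by blast
  then have "\<forall>Q\<in>branch_polys R. invariant_under K Q \<longrightarrow> rep Q"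
    using descend[OF finH order_refl] extension(6) by simp
  then show ?case using extension(5,7) by blast
qed

section \<open>Solvable monodromy implies representability by roots and sums\<close>

lemma generated_by_self:
  assumes "analytic_near f a"
  shows "germ_at a f \<in> generated_by (germ_at a f)"
proof -
  from assms obtain U where U: "open U" "a \<in> U" "holomorphic_several f U"
    by (auto simp: analytic_near_def)
  have "continues_to (linepath a a) (germ_at a f) (germ_at a f)"
    using continues_to_within[OF U(3,1) path_linepath, of a a] U(2) by simp
  then show ?thesis by (auto simp: generated_by_def)
qed

theorem theorem3p5:
  fixes P :: "'n::{finite,linorder} mpoly poly"
    and y :: "'n germ set"
    and x0 :: "complex ^ 'n::{finite,linorder}"
  assumes "algebraic_function P y"
    and "x0 \<notin> branch_locus P"
    and "solvable (monodromy_group P x0)"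
  shows "y \<in> representable"
proof -
  let ?R = "solution_germs P x0"
  note x0 = assms(2)
  obtain a g where g: "g \<in> solution_germs P a" and y: "y = generated_by g"
    using assms(1) by (auto simp: algebraic_function_def)
  \<comment> \<open>The point \<open>a\<close> may lie on the branch locus; a first step leads to a nearby point \<open>b\<close> outside it.\<close>
  obtain g0 where g0: "g0 \<in> ?R" and y0: "y = generated_by g0"
  proof -
    from g obtain h where h: "g = germ_at a h" "analytic_near h a"
      "\<forall>\<^sub>F x in nhds a. poly (equation_at P x) (h x) = 0"
      by (auto simp: solution_germs_def)
    obtain U where U: "open U" "a \<in> U" "holomorphic_several h U"
      using h(2) by (auto simp: analytic_near_def)
    obtain V where V: "open V" "a \<in> V" "\<And>x. x \<in> V \<Longrightarrow> poly (equation_at P x) (h x) = 0"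
      using h(3) by (auto simp: eventually_nhds)
    obtain e where e: "e > 0" "ball a e \<subseteq> U \<inter> V"
      using openE[OF open_Int[OF U(1) V(1)], of a] U(2) V(2) by blast
    have hol: "holomorphic_several h (ball a e)"
      using holomorphic_several_subset[OF U(3)] e(2) by blast
    obtain b where b: "b \<in> ball a e" "b \<notin> branch_locus P"
      using branch_locus_complement_dense[OF x0 open_ball, of a a e] e(1) by auto
    have "path_image (linepath a b) \<subseteq> ball a e"
      using e(1) b(1) by (simp add: closed_segment_subset)
    from continues_to_within[OF hol open_ball path_linepath this]
    have gb: "continues_to (linepath a b) g (germ_at b h)" by (simp add: h(1))
    have "\<forall>\<^sub>F x in nhds b. poly (equation_at P x) (h x) = 0"
      unfolding eventually_nhds using b(1) e(2) V(3) by (intro exI[of _ "ball a e"]) auto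
    moreover have "analytic_near h b"
      unfolding analytic_near_def using hol b(1) by (intro exI[of _ "ball a e"]) auto
    ultimately have germ_b: "germ_at b h \<in> solution_germs P b" by (auto simp: solution_germs_def)
    obtain \<gamma> where \<gamma>: "path \<gamma>" "pathstart \<gamma> = b" "pathfinish \<gamma> = x0" "path_image \<gamma> \<inter> branch_locus P = {}"
      by (rule branch_locus_complement_connected[OF b(2) x0])
    obtain k where k: "continues_to \<gamma> (germ_at b h) k" "k \<in> ?R"
      using solution_germ_continues[OF \<gamma>(1,4)] germ_b \<gamma>(2,3) by metis
    show ?thesis
      using that[OF k(2)] y generated_by_eq[OF gb] generated_by_eq[OF k(1)] by simp
  qed
  obtain r f where r: "r > 0" "ball x0 r \<inter> branch_locus P = {}"
    and f: "\<And>g. g \<in> ?R \<Longrightarrow> holomorphic_several (f g) (ball x0 r) \<and> germ_at x0 (f g) = g"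
    by (rule branch_functions[OF x0]) blast
  define ev where "ev Q x = Q (\<lambda>g. f g x)" for Q :: "('n germ \<Rightarrow> complex) \<Rightarrow> complex" and x
  define rep where "rep Q \<longleftrightarrow> generated_by (germ_at x0 (ev Q)) \<in> representable" for Q
  have analytic: "analytic_near (ev Q) x0" if Q: "Q \<in> branch_polys ?R" for Q
    unfolding analytic_near_def
  proof (intro exI[of _ "ball x0 r"] conjI)
    show "holomorphic_several (ev Q) (ball x0 r)"
      unfolding holomorphic_several_iff ev_def[abs_def]
      using f by (intro ballI branch_polys_complex_diff_at[OF Q]) (auto simp: holomorphic_several_iff)
  qed (use r(1) in auto)
  \<comment> \<open>The variable of \<open>g0\<close> is a polynomial in the branches; substitution gives back the germ \<open>g0\<close>.\<close>
  have "rep (\<lambda>z. z g0)"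
  proof (rule solvable_resolvents[where R = ?R and rep = rep])
    show "solvable_seq (BijGroup ?R\<lparr>carrier := monodromy_perm P x0 ` loops_avoiding (branch_locus P) x0\<rparr>)
        (monodromy_perm P x0 ` loops_avoiding (branch_locus P) x0)"
      using assms(3) by (simp add: solvable_def monodromy_group_def)
    show "monodromy_perm P x0 ` loops_avoiding (branch_locus P) x0 \<subseteq> Bij ?R"
      using monodromy_perm_Bij by blast
    show "finite ?R" by (rule finite_solution_germs[OF x0])
    show "(\<lambda>z. z g0) \<in> branch_polys ?R" by (rule branch_polys.coord[OF g0])
    show "rep Q" if Q: "Q \<in> branch_polys ?R" "m \<ge> 2" "rep (\<lambda>z. Q z ^ m)" for Q m
    proof -
      have "germ_at x0 (\<lambda>x. ev Q x ^ m) \<in> generated_by (germ_at x0 (ev (\<lambda>z. Q z ^ m)))"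
        using generated_by_self[OF analytic[OF branch_polys_power[OF Q(1)]], of m] by (simp add: ev_def[abs_def])
      with representable.root[OF _ Q(2) analytic[OF Q(1)]] Q(3) show ?thesis
        unfolding rep_def by blast
    qed
    have const: "rep (\<lambda>z. c)" for c
    proof -
      obtain p :: "'n mpoly" where p: "(\<lambda>x. c) = mpoly_eval p"
        using polynomial_map_const[of c] unfolding polynomial_map_def by blast
      obtain q :: "'n mpoly" where q: "(\<lambda>x. 1) = mpoly_eval q"
        using polynomial_map_const[of 1] unfolding polynomial_map_def by blast
      have "mpoly_eval q x0 \<noteq> 0" using fun_cong[OF q, of x0] by simp
      from representable.rational[OF this, of p] show ?thesis
        by (simp add: rep_def ev_def[abs_def] p[symmetric] q[symmetric])
    qed
    show "rep (\<lambda>z. \<Sum>j<m. Q j z)"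
      if "\<And>j. j < m \<Longrightarrow> Q j \<in> branch_polys ?R" "\<And>j. j < m \<Longrightarrow> rep (Q j)" for Q and m :: nat
      using that
    proof (induction m)
      case 0
      then show ?case using const[of 0] by simp
    next
      case (Suc m)
      have Qs: "(\<lambda>z. \<Sum>j<m. Q j z) \<in> branch_polys ?R"
        using Suc.prems(1) by (intro branch_polys_sum) auto
      have "generated_by (germ_at x0 (\<lambda>x. ev (\<lambda>z. \<Sum>j<m. Q j z) x + ev (Q m) x)) \<in> representable"
        using Suc by (intro representable.sum[OF _ _ generated_by_self[OF analytic[OF Qs]]
            generated_by_self[OF analytic[of "Q m"]]]) (auto simp: rep_def)
      then show ?case by (simp add: rep_def ev_def[abs_def])
    qed
    show "rep Q" if Q: "Q \<in> branch_polys ?R"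
      "invariant_under (monodromy_perm P x0 ` loops_avoiding (branch_locus P) x0) Q" for Q
    proof -
      obtain p q where pq: "mpoly_eval q x0 \<noteq> 0"
        "\<forall>\<^sub>F x in nhds x0. Q (\<lambda>g. f g x) = mpoly_eval p x / mpoly_eval q x"
        using monodromy_invariant_is_rational[OF x0 r f Q(1)] Q(2) by (auto simp: invariant_under_def)
      then have "germ_at x0 (ev Q) = germ_at x0 (\<lambda>x. mpoly_eval p x / mpoly_eval q x)"
        by (simp add: germ_at_eq_iff ev_def[abs_def])
      then show ?thesis using representable.rational[OF pq(1), of p] by (simp add: rep_def)
    qed
  qed
  moreover have "germ_at x0 (ev (\<lambda>z. z g0)) = g0" using f[OF g0] by (simp add: ev_def[abs_def])
  ultimately show ?thesis by (simp add: rep_def y0)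
qed

end
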